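(* Let $F_1$ and $F_2$ be two algebraically closed fields containing a field $K$. Let $A$ and $B$ be two $K$-algebras of finite dimension. Then $A_{F_1}$ and $B_{F_1}$ are isomorphic as $F_1$-algebras if and only if $A_{F_2}$ and $B_{F_2}$ are isomorphic as $F_2$-algebras.
   Context: Algebras are not necessarily associative, commutative or unital. For a $K$-algebra $A$ and a field extension $K\subseteq F$, $A_F:=A\otimes_K F$, regarded as an $F$-algebra. *)

theory Defs
  imports
    "HOL-Computational_Algebra.Computational_Algebra"
    "HOL-Library.Poly_Mapping"
begin

section \<open>Algebras over a field\<close>

text \<open>No associativity, commutativity or unit is assumed.\<close>

locale algebra_over = vector_space scale
  for scale :: "'k::field \<Rightarrow> 'a::ab_group_add \<Rightarrow> 'a" +
  fixes mul :: "'a \<Rightarrow> 'a \<Rightarrow> 'a"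
  assumes linear_mul_left: "Vector_Spaces.linear scale scale (\<lambda>x. mul x y)"
    and linear_mul_right: "Vector_Spaces.linear scale scale (\<lambda>y. mul x y)"

locale finite_dim_algebra_over = algebra_over +
  assumes finite_dim: "\<exists>Basis. finite_dimensional_vector_space scale Basis"

text \<open>
  A field \<open>F\<close> containing \<open>K\<close> is given by its embedding \<open>K \<Rightarrow> F\<close>, since \<open>K\<close> and \<open>F\<close>
  are types. Injectivity is automatic for unital homomorphisms of fields.
\<close>

locale field_embedding =
  fixes \<iota> :: "'k::field \<Rightarrow> 'f::field"
  assumes hom_add: "\<iota> (c + d) = \<iota> c + \<iota> d"
    and hom_mult: "\<iota> (c * d) = \<iota> c * \<iota> d"
    and hom_one: "\<iota> 1 = 1"

lemma (in field_embedding) hom_inj: "inj \<iota>"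
proof (rule injI, rule ccontr)
  have zero: "\<iota> 0 = 0"
    by (metis add_0 add_cancel_right_right hom_add)
  fix c d assume eq: "\<iota> c = \<iota> d" and "c \<noteq> d"
  then have "\<iota> ((c - d) * inverse (c - d)) = 1"
    by (simp add: hom_one)
  moreover have "\<iota> (c - d) = 0"
    using hom_add[of "c - d" d] eq by simp
  ultimately show False
    by (simp add: hom_mult)
qed


section \<open>Algebras with a carrier set, and isomorphism\<close>

text \<open>
  The tensor product below lives on a set of cosets, which depends on \<open>A\<close> and on the
  embedding \<open>K \<Rightarrow> F\<close> and so cannot be a type.
\<close>

record ('f, 'v) alg =
  carrier :: "'v set"
  add :: "'v \<Rightarrow> 'v \<Rightarrow> 'v"
  mult :: "'v \<Rightarrow> 'v \<Rightarrow> 'v"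
  smult :: "'f \<Rightarrow> 'v \<Rightarrow> 'v"

definition alg_iso :: "('f, 'v) alg \<Rightarrow> ('f, 'w) alg \<Rightarrow> ('v \<Rightarrow> 'w) set" where
  "alg_iso V W = {h. bij_betw h (carrier V) (carrier W) \<and>
     (\<forall>x\<in>carrier V. \<forall>y\<in>carrier V. h (add V x y) = add W (h x) (h y)) \<and>
     (\<forall>x\<in>carrier V. \<forall>y\<in>carrier V. h (mult V x y) = mult W (h x) (h y)) \<and>
     (\<forall>z. \<forall>x\<in>carrier V. h (smult V z x) = smult W z (h x))}"

definition alg_isomorphic :: "('f, 'v) alg \<Rightarrow> ('f, 'w) alg \<Rightarrow> bool" (infix "\<cong>\<^sub>a" 50) where
  "V \<cong>\<^sub>a W \<longleftrightarrow> alg_iso V W \<noteq> {}"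


section \<open>Extension of scalars\<close>

text \<open>
  \<open>A \<otimes>\<^sub>K F\<close> is the free abelian group on \<open>A \<times> F\<close> modulo the subgroup generated by the
  relations expressing biadditivity and \<open>ca \<otimes> x = a \<otimes> cx\<close> for \<open>c\<close> in \<open>K\<close>; the
  generator \<open>frag_of (a, x)\<close> represents \<open>a \<otimes> x\<close>.
\<close>

definition tensor_relators ::
    "('k \<Rightarrow> 'f) \<Rightarrow> ('k \<Rightarrow> 'a \<Rightarrow> 'a) \<Rightarrow> ('a::ab_group_add \<times> 'f::field \<Rightarrow>\<^sub>0 int) set" where
  "tensor_relators \<iota> scale =
     {frag_of (a + b, x) - frag_of (a, x) - frag_of (b, x) | a b x. True} \<union>
     {frag_of (a, x + y) - frag_of (a, x) - frag_of (a, y) | a x y. True} \<union>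
     {frag_of (scale c a, x) - frag_of (a, \<iota> c * x) | c a x. True}"

definition tensor_rel ::
    "('k \<Rightarrow> 'f) \<Rightarrow> ('k \<Rightarrow> 'a \<Rightarrow> 'a) \<Rightarrow> ('a::ab_group_add \<times> 'f::field \<Rightarrow>\<^sub>0 int) rel" where
  "tensor_rel \<iota> scale = {(u, v). u - v \<in> group_closure (tensor_relators \<iota> scale)}"

text \<open>
  Products and scalar multiples of representatives, extended (bi)additively from
  \<open>(a \<otimes> x)(b \<otimes> y) = ab \<otimes> xy\<close> and \<open>z(a \<otimes> x) = a \<otimes> zx\<close>.
\<close>

definition tensor_mult ::
    "('a \<Rightarrow> 'a \<Rightarrow> 'a) \<Rightarrow> ('a \<times> 'f \<Rightarrow>\<^sub>0 int) \<Rightarrow> ('a \<times> 'f \<Rightarrow>\<^sub>0 int) \<Rightarrow> ('a \<times> 'f::field \<Rightarrow>\<^sub>0 int)" where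
  "tensor_mult mul u v =
     frag_extend (\<lambda>(a, x). frag_extend (\<lambda>(b, y). frag_of (mul a b, x * y)) v) u"

definition tensor_smult :: "'f \<Rightarrow> ('a \<times> 'f \<Rightarrow>\<^sub>0 int) \<Rightarrow> ('a \<times> 'f::field \<Rightarrow>\<^sub>0 int)" where
  "tensor_smult z u = frag_extend (\<lambda>(a, x). frag_of (a, z * x)) u"

definition scalar_extension ::
    "('k \<Rightarrow> 'f) \<Rightarrow> ('k \<Rightarrow> 'a \<Rightarrow> 'a) \<Rightarrow> ('a \<Rightarrow> 'a \<Rightarrow> 'a) \<Rightarrow>
     ('f::field, ('a::ab_group_add \<times> 'f \<Rightarrow>\<^sub>0 int) set) alg" where
  "scalar_extension \<iota> scale mul =
    (let R = tensor_rel \<iota> scale in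
     \<lparr>carrier = UNIV // R,
      add = (\<lambda>X Y. \<Union>u\<in>X. \<Union>v\<in>Y. R `` {u + v}),
      mult = (\<lambda>X Y. \<Union>u\<in>X. \<Union>v\<in>Y. R `` {tensor_mult mul u v}),
      smult = (\<lambda>z X. \<Union>u\<in>X. R `` {tensor_smult z u})\<rparr>)"

text \<open>The operations do not depend on the representatives.\<close>

lemma equiv_tensor_rel: "equiv UNIV (tensor_rel \<iota> scale)"
proof (rule equivI)
  show "refl (tensor_rel \<iota> scale)"
    by (auto simp: refl_on_def tensor_rel_def)
  show "sym (tensor_rel \<iota> scale)"
  proof (rule symI)
    fix u v assume "(u, v) \<in> tensor_rel \<iota> scale"
    then show "(v, u) \<in> tensor_rel \<iota> scale"
      using group_closure_minus_iff[of "u - v"] by (simp add: tensor_rel_def)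
  qed
  show "trans (tensor_rel \<iota> scale)"
  proof (rule transI)
    fix u v w assume "(u, v) \<in> tensor_rel \<iota> scale" "(v, w) \<in> tensor_rel \<iota> scale"
    then show "(u, w) \<in> tensor_rel \<iota> scale"
      using group_closure_add[of "u - v" _ "v - w"] by (simp add: tensor_rel_def)
  qed
qed auto

lemma tensor_relators_closure:
  "r \<in> tensor_relators \<iota> scale \<Longrightarrow> r \<in> group_closure (tensor_relators \<iota> scale)"
  by (simp add: group_closure.base)

lemma group_closure_image:
  assumes "r \<in> group_closure S"
    and "h 0 = 0" "\<And>u v. h (u - v) = h u - h v"
    and "\<And>s. s \<in> S \<Longrightarrow> h s \<in> group_closure T"
  shows "h r \<in> group_closure T"
  using assms(1)
  by induction (use assms(2-) in \<open>auto intro: group_closure.diff\<close>)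

lemma tensor_add_respects:
  "(\<lambda>u v. tensor_rel \<iota> scale `` {u + v}) respects2 tensor_rel \<iota> scale"
proof (rule congruent2I')
  fix u u' v v' assume "(u, u') \<in> tensor_rel \<iota> scale" "(v, v') \<in> tensor_rel \<iota> scale"
  then have "(u + v, u' + v') \<in> tensor_rel \<iota> scale"
    using group_closure_add[of "u - u'" _ "v - v'"]
    by (simp add: tensor_rel_def algebra_simps)
  then show "tensor_rel \<iota> scale `` {u + v} = tensor_rel \<iota> scale `` {u' + v'}"
    by (rule equiv_class_eq[OF equiv_tensor_rel])
qed

lemma tensor_smult_respects:
  "(\<lambda>u. tensor_rel \<iota> scale `` {tensor_smult z u}) respects tensor_rel \<iota> scale"
proof (rule congruentI)
  fix u u' assume "(u, u') \<in> tensor_rel \<iota> scale"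
  then have *: "u - u' \<in> group_closure (tensor_relators \<iota> scale)"
    by (simp add: tensor_rel_def)
  have "tensor_smult z (u - u') \<in> group_closure (tensor_relators \<iota> scale)"
    using *
  proof (rule group_closure_image)
    fix r assume "r \<in> tensor_relators \<iota> scale"
    then have "tensor_smult z r \<in> tensor_relators \<iota> scale"
      unfolding tensor_relators_def
      by (elim UnE CollectE exE conjE)
        (simp only: tensor_smult_def frag_extend_diff frag_extend_of prod.case
            distrib_left mult.left_commute[of z], blast)+
    then show "tensor_smult z r \<in> group_closure (tensor_relators \<iota> scale)"
      by (rule tensor_relators_closure)
  qed (simp_all add: tensor_smult_def frag_extend_diff)
  then have "(tensor_smult z u, tensor_smult z u') \<in> tensor_rel \<iota> scale"
    by (simp add: tensor_rel_def tensor_smult_def frag_extend_diff)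
  then show "tensor_rel \<iota> scale `` {tensor_smult z u} = tensor_rel \<iota> scale `` {tensor_smult z u'}"
    by (rule equiv_class_eq[OF equiv_tensor_rel])
qed

lemma tensor_mult_diff_left: "tensor_mult mul (u - u') v = tensor_mult mul u v - tensor_mult mul u' v"
  by (simp add: tensor_mult_def frag_extend_diff)

lemma tensor_mult_diff_right: "tensor_mult mul u (v - v') = tensor_mult mul u v - tensor_mult mul u v'"
  using subset_UNIV
proof (induction u rule: frag_induction)
  case (diff a b)
  then show ?case
    by (simp add: tensor_mult_diff_left)
qed (auto simp: tensor_mult_def frag_extend_diff)

context algebra_over
begin

lemma tensor_mult_relator_left:
  assumes "r \<in> group_closure (tensor_relators \<iota> scale)"
  shows "tensor_mult mul r v \<in> group_closure (tensor_relators \<iota> scale)"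
  using subset_UNIV
proof (induction v rule: frag_induction)
  case zero
  show ?case
    using tensor_mult_diff_right[of mul r 0 0] by simp
next
  case (one p)
  obtain b y where p: "p = (b, y)"
    by (cases p)
  interpret m: Vector_Spaces.linear scale scale "\<lambda>a. mul a b"
    by (rule linear_mul_left)
  show ?case
    using assms
  proof (rule group_closure_image)
    fix s assume "s \<in> tensor_relators \<iota> scale"
    then have "tensor_mult mul s (frag_of p) \<in> tensor_relators \<iota> scale"
      unfolding tensor_relators_def
      by (elim UnE CollectE exE conjE)
        (simp only: tensor_mult_def frag_extend_diff frag_extend_of prod.case p
            m.add m.scale distrib_right mult.assoc, blast)+
    then show "tensor_mult mul s (frag_of p) \<in> group_closure (tensor_relators \<iota> scale)"
      by (rule tensor_relators_closure)
  qed (simp_all add: tensor_mult_def frag_extend_diff)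
next
  case (diff a b)
  then show ?case
    by (simp add: tensor_mult_diff_right group_closure.diff)
qed

lemma tensor_mult_relator_right:
  assumes "r \<in> group_closure (tensor_relators \<iota> scale)"
  shows "tensor_mult mul u r \<in> group_closure (tensor_relators \<iota> scale)"
  using subset_UNIV
proof (induction u rule: frag_induction)
  case zero
  show ?case
    by (simp add: tensor_mult_def)
next
  case (one p)
  obtain b y where p: "p = (b, y)"
    by (cases p)
  interpret m: Vector_Spaces.linear scale scale "\<lambda>a. mul b a"
    by (rule linear_mul_right)
  show ?case
    using assms
  proof (rule group_closure_image)
    fix s assume "s \<in> tensor_relators \<iota> scale"
    then have "tensor_mult mul (frag_of p) s \<in> tensor_relators \<iota> scale"
      unfolding tensor_relators_def
      by (elim UnE CollectE exE conjE)
        (simp only: tensor_mult_def frag_extend_diff frag_extend_of prod.case p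
            m.add m.scale distrib_left mult.left_commute[of y], blast)+
    then show "tensor_mult mul (frag_of p) s \<in> group_closure (tensor_relators \<iota> scale)"
      by (rule tensor_relators_closure)
  qed (simp_all add: tensor_mult_def frag_extend_diff p)
next
  case (diff a b)
  then show ?case
    by (simp add: tensor_mult_diff_left group_closure.diff)
qed

lemma tensor_mult_respects:
  "(\<lambda>u v. tensor_rel \<iota> scale `` {tensor_mult mul u v}) respects2 tensor_rel \<iota> scale"
proof (rule congruent2I')
  fix u u' v v' assume uv: "(u, u') \<in> tensor_rel \<iota> scale" "(v, v') \<in> tensor_rel \<iota> scale"
  have "tensor_mult mul u v - tensor_mult mul u' v' =
      tensor_mult mul (u - u') v + tensor_mult mul u' (v - v')"
    by (simp add: tensor_mult_diff_left tensor_mult_diff_right)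
  then have "(tensor_mult mul u v, tensor_mult mul u' v') \<in> tensor_rel \<iota> scale"
    using uv
    by (simp only: tensor_rel_def mem_Collect_eq prod.case)
      (intro group_closure_add tensor_mult_relator_left tensor_mult_relator_right)
  then show "tensor_rel \<iota> scale `` {tensor_mult mul u v} = tensor_rel \<iota> scale `` {tensor_mult mul u' v'}"
    by (rule equiv_class_eq[OF equiv_tensor_rel])
qed

lemma scalar_extension_simps:
  fixes \<iota> :: "'k \<Rightarrow> 'f::field"
  defines "R \<equiv> tensor_rel \<iota> scale"
  shows "carrier (scalar_extension \<iota> scale mul) = UNIV // R"
    and "add (scalar_extension \<iota> scale mul) (R `` {u}) (R `` {v}) = R `` {u + v}"
    and "mult (scalar_extension \<iota> scale mul) (R `` {u}) (R `` {v}) = R `` {tensor_mult mul u v}"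
    and "smult (scalar_extension \<iota> scale mul) z (R `` {u}) = R `` {tensor_smult z u}"
  unfolding R_def scalar_extension_def Let_def
  by (simp_all add: UN_equiv_class2[OF equiv_tensor_rel equiv_tensor_rel tensor_add_respects]
      UN_equiv_class2[OF equiv_tensor_rel equiv_tensor_rel tensor_mult_respects]
      UN_equiv_class[OF equiv_tensor_rel tensor_smult_respects])

end

end

theory Submission
  imports Defs
begin

text \<open>
  Choose \<open>K\<close>-bases of \<open>A\<close> and \<open>B\<close>. They are also bases of \<open>A\<^sub>F\<close> and \<open>B\<^sub>F\<close> over \<open>F\<close>, with the same
  structure constants, so an isomorphism between \<open>A\<^sub>F\<close> and \<open>B\<^sub>F\<close> is a pair of mutually inverse
  matrices over \<open>F\<close> that satisfies finitely many polynomial equations whose coefficients come from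
  \<open>K\<close> (\<open>scalar_extensions_isomorphic_iff_matrices\<close>). By the Nullstellensatz, whether such a system
  is solvable in an algebraically closed field \<open>F\<close> does not depend on \<open>F\<close>.
  
  The form of the Nullstellensatz used here speaks about rings of elements instead of ideals of
  polynomials (\<open>specialization_to_alg_closed\<close>): given finitely many elements of a field \<open>F\<^sub>1\<close>
  containing \<open>K\<close>, there is a homomorphism over \<open>K\<close> from a subring containing them to any
  algebraically closed field \<open>F\<^sub>2\<close> containing \<open>K\<close>. Applied to the entries of the two matrices, it yields
  matrices over \<open>F\<^sub>2\<close> that satisfy the same equations.
  
  The homomorphism is built by adjoining the elements one at a time. Not every homomorphism on a ring
  \<open>R\<close> extends to \<open>R[x]\<close>, but those that do not send a suitable \<open>u \<noteq> 0\<close> to \<open>0\<close> do, and a given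
  \<open>v \<noteq> 0\<close> in \<open>R[x]\<close> can even be kept from going to \<open>0\<close> (\<open>extend_hom_adjoin\<close>). This statement passes
  to repeated adjunctions, and at the bottom, where \<open>R\<close> is the field \<open>K\<close>, the condition on \<open>u\<close> holds
  trivially. The only tools are roots of nonzero polynomials in one variable and pseudo-division.
\<close>

(* From here on, smult is the multiplication of a polynomial by a scalar;
   the scalar multiplication of an algebra is alg.smult. *)
hide_const (open) smult

section \<open>Subrings and their homomorphisms\<close>

text \<open>
  The homomorphisms to be constructed are defined only on part of a field, and that part grows
  during the construction. A subring is therefore a set, and a homomorphism on it is a total
  function with unspecified values elsewhere.
\<close>

locale subring =
  fixes R :: "'f::comm_ring_1 set"
  assumes one_closed: "1 \<in> R"
    and diff_closed: "c \<in> R \<Longrightarrow> d \<in> R \<Longrightarrow> c - d \<in> R"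
    and mult_closed: "c \<in> R \<Longrightarrow> d \<in> R \<Longrightarrow> c * d \<in> R"
begin

lemma zero_closed: "0 \<in> R"
  using diff_closed[OF one_closed one_closed] by simp

lemma add_closed: "c \<in> R \<Longrightarrow> d \<in> R \<Longrightarrow> c + d \<in> R"
  using diff_closed[OF _ diff_closed[OF zero_closed]] by force

lemma power_closed: "c \<in> R \<Longrightarrow> c ^ n \<in> R"
  by (induction n) (auto intro: one_closed mult_closed)

lemma sum_closed: "(\<And>i. i \<in> I \<Longrightarrow> g i \<in> R) \<Longrightarrow> sum g I \<in> R"
  by (induction I rule: infinite_finite_induct) (auto intro: zero_closed add_closed)

end

locale subring_hom = subring R for R :: "'f::comm_ring_1 set" +
  fixes \<phi> :: "'f \<Rightarrow> 'w::comm_ring_1"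
  assumes hom_one: "\<phi> 1 = 1"
    and hom_add: "c \<in> R \<Longrightarrow> d \<in> R \<Longrightarrow> \<phi> (c + d) = \<phi> c + \<phi> d"
    and hom_mult: "c \<in> R \<Longrightarrow> d \<in> R \<Longrightarrow> \<phi> (c * d) = \<phi> c * \<phi> d"
begin

lemma hom_zero: "\<phi> 0 = 0"
  using hom_add[OF zero_closed zero_closed] by simp

lemma hom_diff: "c \<in> R \<Longrightarrow> d \<in> R \<Longrightarrow> \<phi> (c - d) = \<phi> c - \<phi> d"
  using hom_add[OF diff_closed, of c d d] by (simp add: algebra_simps)

lemma hom_power: "c \<in> R \<Longrightarrow> \<phi> (c ^ n) = \<phi> c ^ n"
  by (induction n) (simp_all add: hom_one hom_mult power_closed)

lemma hom_sum: "(\<And>i. i \<in> I \<Longrightarrow> g i \<in> R) \<Longrightarrow> \<phi> (sum g I) = (\<Sum>i\<in>I. \<phi> (g i))"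
  by (induction I rule: infinite_finite_induct) (auto simp: hom_zero hom_add sum_closed)

end

section \<open>Adjoining one element\<close>

definition polys_over :: "'f::zero set \<Rightarrow> 'f poly set" where
  "polys_over R = {p. \<forall>i. coeff p i \<in> R}"

definition adjoin :: "'f::comm_ring_1 set \<Rightarrow> 'f \<Rightarrow> 'f set" where
  "adjoin R x = (\<lambda>p. poly p x) ` polys_over R"

context subring
begin

lemma polys_over_diff: "p \<in> polys_over R \<Longrightarrow> q \<in> polys_over R \<Longrightarrow> p - q \<in> polys_over R"
  by (auto simp: polys_over_def diff_closed)

lemma polys_over_add: "p \<in> polys_over R \<Longrightarrow> q \<in> polys_over R \<Longrightarrow> p + q \<in> polys_over R"
  by (auto simp: polys_over_def add_closed)

lemma polys_over_mult: "p \<in> polys_over R \<Longrightarrow> q \<in> polys_over R \<Longrightarrow> p * q \<in> polys_over R"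
  by (auto simp: polys_over_def coeff_mult intro: sum_closed mult_closed)

lemma polys_over_smult: "c \<in> R \<Longrightarrow> p \<in> polys_over R \<Longrightarrow> smult c p \<in> polys_over R"
  by (auto simp: polys_over_def mult_closed)

lemma polys_over_monom: "c \<in> R \<Longrightarrow> monom c n \<in> polys_over R"
  by (auto simp: polys_over_def zero_closed)

lemma polys_over_const: "c \<in> R \<Longrightarrow> [:c:] \<in> polys_over R"
  by (auto simp: polys_over_def coeff_pCons zero_closed split: nat.split)

lemma polys_over_zero: "0 \<in> polys_over R"
  by (auto simp: polys_over_def zero_closed)

lemma polys_over_one: "1 \<in> polys_over R"
  using polys_over_const[OF one_closed] by (simp only: one_pCons)

lemma coeff_polys_over: "p \<in> polys_over R \<Longrightarrow> coeff p i \<in> R"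
  by (simp add: polys_over_def)

lemma subring_adjoin: "subring (adjoin R x)"
proof
  show "1 \<in> adjoin R x"
    unfolding adjoin_def by (rule image_eqI[OF _ polys_over_one]) simp
next
  fix c d assume "c \<in> adjoin R x" "d \<in> adjoin R x"
  then obtain p q where pq: "p \<in> polys_over R" "q \<in> polys_over R" "c = poly p x" "d = poly q x"
    by (auto simp: adjoin_def)
  show "c - d \<in> adjoin R x"
    unfolding adjoin_def by (rule image_eqI[OF _ polys_over_diff[OF pq(1,2)]]) (simp add: pq)
  show "c * d \<in> adjoin R x"
    unfolding adjoin_def by (rule image_eqI[OF _ polys_over_mult[OF pq(1,2)]]) (simp add: pq)
qed

lemma subset_adjoin: "R \<subseteq> adjoin R x"
proof
  fix c assume "c \<in> R"
  show "c \<in> adjoin R x"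
    unfolding adjoin_def by (rule image_eqI[OF _ polys_over_const[OF \<open>c \<in> R\<close>]]) simp
qed

lemma mem_adjoin: "x \<in> adjoin R x"
  unfolding adjoin_def by (rule image_eqI[OF _ polys_over_monom[OF one_closed, of 1]]) (simp add: poly_monom)

text \<open>
  Division with remainder by \<open>m\<close> without leaving \<open>R\<close>: \<open>R\<close> need not contain the inverse of the
  leading coefficient of \<open>m\<close>, so the dividend is multiplied by a power of it beforehand.
\<close>

lemma pseudo_division:
  assumes "m \<in> polys_over R" "m \<noteq> 0" "p \<in> polys_over R"
  obtains k s r where "s \<in> polys_over R" "r \<in> polys_over R"
    and "smult (lead_coeff m ^ k) p = m * s + r" "r = 0 \<or> degree r < degree m"
proof -
  have "\<exists>k s r. s \<in> polys_over R \<and> r \<in> polys_over R \<and>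
      smult (lead_coeff m ^ k) p = m * s + r \<and> (r = 0 \<or> degree r < degree m)"
    using assms(3)
  \<comment> \<open>Measuring by the number of coefficients instead of the degree makes a drop from a nonzero
      constant to \<open>0\<close> count as progress.\<close>
  proof (induction "length (coeffs p)" arbitrary: p rule: less_induct)
    case less
    show ?case
    proof (cases "p = 0 \<or> degree p < degree m")
      case True
      then show ?thesis
        using less.prems polys_over_zero by (intro exI[of _ 0] exI[of _ p]) auto
    next
      case False
      define t where "t = monom (lead_coeff p) (degree p - degree m)"
      define p' where "p' = smult (lead_coeff m) p - t * m"
      have t: "t \<in> polys_over R"
        using less.prems by (simp add: t_def polys_over_monom coeff_polys_over)
      have p': "p' \<in> polys_over R"
        unfolding p'_def using less.prems assms(1) t
        by (intro polys_over_diff polys_over_smult polys_over_mult coeff_polys_over)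
      have "degree (t * m) \<le> degree p"
        using degree_mult_le[of t m] degree_monom_le[of "lead_coeff p" "degree p - degree m"] False
        unfolding t_def by linarith
      then have "degree p' \<le> degree p"
        unfolding p'_def by (intro degree_diff_le degree_smult_le)
      moreover have "coeff p' (degree p) = 0"
        using False by (simp add: p'_def t_def coeff_monom_mult mult.commute[of "lead_coeff p"])
      ultimately have "p' = 0 \<or> degree p' < degree p"
        using leading_coeff_0_iff[of p'] by (cases "degree p' = degree p") (simp, linarith)
      then have "length (coeffs p') < length (coeffs p)"
        using False by (cases "p' = 0") (auto simp: length_coeffs)
      from less.hyps[OF this p'] obtain k s r where
        *: "s \<in> polys_over R" "r \<in> polys_over R" "r = 0 \<or> degree r < degree m"
          "smult (lead_coeff m ^ k) p' = m * s + r"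
        by blast
      have "smult (lead_coeff m ^ Suc k) p = m * (s + smult (lead_coeff m ^ k) t) + r"
        using *(4) by (simp add: p'_def smult_diff_right algebra_simps)
      moreover have "s + smult (lead_coeff m ^ k) t \<in> polys_over R"
        using * t assms(1) by (intro polys_over_add polys_over_smult power_closed coeff_polys_over)
      ultimately show ?thesis
        using * by blast
    qed
  qed
  then show thesis
    using that by blast
qed

end

context subring_hom
begin

lemma map_poly_hom_coeff: "coeff (map_poly \<phi> p) i = \<phi> (coeff p i)"
  by (simp add: coeff_map_poly hom_zero)

lemma map_poly_hom_add:
  "p \<in> polys_over R \<Longrightarrow> q \<in> polys_over R \<Longrightarrow> map_poly \<phi> (p + q) = map_poly \<phi> p + map_poly \<phi> q"
  by (intro poly_eqI) (simp add: map_poly_hom_coeff hom_add coeff_polys_over)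

lemma map_poly_hom_diff:
  "p \<in> polys_over R \<Longrightarrow> q \<in> polys_over R \<Longrightarrow> map_poly \<phi> (p - q) = map_poly \<phi> p - map_poly \<phi> q"
  by (intro poly_eqI) (simp add: map_poly_hom_coeff hom_diff coeff_polys_over)

lemma map_poly_hom_smult:
  "c \<in> R \<Longrightarrow> p \<in> polys_over R \<Longrightarrow> map_poly \<phi> (smult c p) = smult (\<phi> c) (map_poly \<phi> p)"
  by (intro poly_eqI) (simp add: map_poly_hom_coeff hom_mult coeff_polys_over)

lemma map_poly_hom_mult:
  "p \<in> polys_over R \<Longrightarrow> q \<in> polys_over R \<Longrightarrow> map_poly \<phi> (p * q) = map_poly \<phi> p * map_poly \<phi> q"
  by (intro poly_eqI)
    (simp add: map_poly_hom_coeff coeff_mult hom_sum hom_mult mult_closed coeff_polys_over)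

text \<open>
  A polynomial in \<open>x\<close> can be sent to the corresponding polynomial in \<open>\<xi>\<close> as soon as every algebraic
  relation of \<open>x\<close> over \<open>R\<close> is also satisfied by \<open>\<xi>\<close>; this is what makes the value independent of
  the polynomial chosen to represent an element of \<open>R[x]\<close>.
\<close>

lemma hom_extend_adjoin:
  assumes "\<And>p. p \<in> polys_over R \<Longrightarrow> poly p x = 0 \<Longrightarrow> poly (map_poly \<phi> p) \<xi> = 0"
  obtains \<psi> where "subring_hom (adjoin R x) \<psi>"
    and "\<And>p. p \<in> polys_over R \<Longrightarrow> \<psi> (poly p x) = poly (map_poly \<phi> p) \<xi>"
    and "\<And>c. c \<in> R \<Longrightarrow> \<psi> c = \<phi> c"
proof -
  define rep where "rep y = (SOME p. p \<in> polys_over R \<and> poly p x = y)" for y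
  define \<psi> where "\<psi> y = poly (map_poly \<phi> (rep y)) \<xi>" for y
  have \<psi>: "\<psi> (poly p x) = poly (map_poly \<phi> p) \<xi>" if p: "p \<in> polys_over R" for p
  proof -
    have rep: "rep (poly p x) \<in> polys_over R \<and> poly (rep (poly p x)) x = poly p x"
      unfolding rep_def by (rule someI) (use p in simp)
    then have "poly (map_poly \<phi> (rep (poly p x) - p)) \<xi> = 0"
      using p by (intro assms) (auto intro: polys_over_diff)
    then show ?thesis
      using rep p by (simp add: \<psi>_def map_poly_hom_diff)
  qed
  have const: "\<psi> c = \<phi> c" if "c \<in> R" for c
    using \<psi>[OF polys_over_const[OF that]] by (simp add: map_poly_pCons hom_zero)
  interpret S: subring "adjoin R x"
    by (rule subring_adjoin)
  have "subring_hom (adjoin R x) \<psi>"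
  proof
    show "\<psi> 1 = 1"
      by (simp add: const one_closed hom_one)
  next
    fix c d assume "c \<in> adjoin R x" "d \<in> adjoin R x"
    then obtain p q where pq: "p \<in> polys_over R" "q \<in> polys_over R" "c = poly p x" "d = poly q x"
      by (auto simp: adjoin_def)
    show "\<psi> (c + d) = \<psi> c + \<psi> d"
      using \<psi>[OF polys_over_add[OF pq(1,2)]] by (simp add: pq \<psi> map_poly_hom_add)
    show "\<psi> (c * d) = \<psi> c * \<psi> d"
      using \<psi>[OF polys_over_mult[OF pq(1,2)]] by (simp add: pq \<psi> map_poly_hom_mult)
  qed
  then show thesis
    using \<psi> const by (rule that)
qed

end

text \<open>
  If \<open>q\<close> is not constant, then \<open>q - 1\<close> has a root, and \<open>q\<close> takes the value \<open>1\<close> there.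
\<close>

lemma alg_closed_exists_non_root:
  fixes q :: "'w::alg_closed_field poly"
  assumes "q \<noteq> 0"
  obtains \<xi> where "poly q \<xi> \<noteq> 0"
proof (cases "degree q = 0")
  case True
  then obtain c where "q = [:c:]"
    using degree_eq_zeroE by blast
  then show thesis
    using assms that by force
next
  case False
  have "degree (q - 1) = degree q"
    using False by (metis degree_1 degree_add_eq_left degree_minus diff_conv_add_uminus gr0I)
  then obtain \<xi> where "poly (q - 1) \<xi> = 0"
    using False alg_closed_imp_poly_has_root[of "q - 1"] by auto
  then show thesis
    using that[of \<xi>] by simp
qed

text \<open>
  Over the fraction field of \<open>R\<close>, the polynomial \<open>m\<close> would be a minimal polynomial of \<open>x\<close>, and
  \<open>R[x]\<close> would become a field. Clearing denominators, every nonzero element of \<open>R[x]\<close> has a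
  multiple that is a nonzero element of \<open>R\<close>. The multiplier comes from the Euclidean algorithm
  for \<open>m\<close> and \<open>p\<close>, run with pseudo-division.
\<close>

lemma minimal_annihilator_invertible:
  fixes R :: "'f::field set"
  assumes "subring R"
    and m: "m \<in> polys_over R" "m \<noteq> 0" "poly m x = 0"
    and min: "\<And>q. q \<in> polys_over R \<Longrightarrow> q \<noteq> 0 \<Longrightarrow> poly q x = 0 \<Longrightarrow> degree m \<le> degree q"
    and p: "p \<in> polys_over R" "poly p x \<noteq> 0"
  obtains s c where "s \<in> polys_over R" "c \<in> R" "c \<noteq> 0" "poly s x * poly p x = c"
proof -
  interpret subring R by fact
  have nz: "poly q x \<noteq> 0" if "q \<in> polys_over R" "q \<noteq> 0" "degree q < degree m" for q
    using min[OF that(1,2)] that(3) by auto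
  have small: "\<exists>s\<in>polys_over R. poly s x * poly p x \<in> R - {0}"
    if "p \<in> polys_over R" "p \<noteq> 0" "degree p < degree m" for p
    using that
  proof (induction "degree p" arbitrary: p rule: less_induct)
    case less
    show ?case
    proof (cases "degree p = 0")
      case True
      then obtain c where "p = [:c:]"
        using degree_eq_zeroE by blast
      with less.prems polys_over_one show ?thesis
        by (intro bexI[of _ 1]) (auto simp: polys_over_def coeff_pCons split: nat.splits dest: spec[of _ 0])
    next
      case False
      \<comment> \<open>One Euclidean step replaces \<open>p\<close> by the remainder \<open>r\<close> of \<open>m\<close>. As \<open>p\<close> is not constant, the quotient
          \<open>s\<close> has smaller degree than \<open>m\<close>, so \<open>s\<close> and \<open>p\<close>, hence also \<open>r\<close>, do not vanish at \<open>x\<close>.\<close>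
      obtain k s r where sr: "s \<in> polys_over R" "r \<in> polys_over R"
        "smult (lead_coeff p ^ k) m = p * s + r" "r = 0 \<or> degree r < degree p"
        using pseudo_division[OF less.prems(1,2) m(1)] by metis
      have deg: "degree (p * s + r) = degree m"
        using less.prems(2) sr(3)[symmetric] by simp
      have "s \<noteq> 0"
        using deg sr(4) less.prems(3) by auto
      have "degree (p * s) = degree p + degree s"
        using less.prems(2) \<open>s \<noteq> 0\<close> by (simp add: degree_mult_eq)
      then have "degree s < degree m"
        using deg sr(4) False degree_add_eq_left[of r "p * s"] by fastforce
      then have "poly s x \<noteq> 0"
        using nz sr(1) \<open>s \<noteq> 0\<close> by blast
      moreover have "poly p x \<noteq> 0"
        using nz less.prems by blast
      moreover have rx: "poly r x = - (poly s x * poly p x)"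
        using arg_cong[OF sr(3), of "\<lambda>q. poly q x"] m(3) by (simp add: algebra_simps eq_neg_iff_add_eq_0)
      ultimately have "r \<noteq> 0"
        by auto
      then obtain s' where s': "s' \<in> polys_over R" "poly s' x * poly r x \<in> R - {0}"
        using less.hyps[of r] sr less.prems(3) by force
      have "- 1 \<in> R"
        using diff_closed[OF zero_closed one_closed] by simp
      then have "smult (- 1) (s' * s) \<in> polys_over R"
        using s' sr by (intro polys_over_smult polys_over_mult)
      moreover have "poly (smult (- 1) (s' * s)) x * poly p x = poly s' x * poly r x"
        by (simp add: rx)
      ultimately show ?thesis
        using s'(2) by metis
    qed
  qed
  \<comment> \<open>A polynomial of larger degree is first reduced modulo \<open>m\<close>.\<close>
  obtain k t r where tr: "t \<in> polys_over R" "r \<in> polys_over R"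
    "smult (lead_coeff m ^ k) p = m * t + r" "r = 0 \<or> degree r < degree m"
    using pseudo_division[OF m(1,2) p(1)] by metis
  have rx: "poly r x = lead_coeff m ^ k * poly p x"
    using arg_cong[OF tr(3), of "\<lambda>q. poly q x"] m(3) by simp
  with p(2) m(2) have "r \<noteq> 0"
    by auto
  then obtain s where s: "s \<in> polys_over R" "poly s x * poly r x \<in> R - {0}"
    using small tr by blast
  show thesis
  proof (rule that)
    show "smult (lead_coeff m ^ k) s \<in> polys_over R"
      using s m by (intro polys_over_smult power_closed coeff_polys_over)
    show "poly (smult (lead_coeff m ^ k) s) x * poly p x = poly s x * poly r x"
      by (simp add: rx)
  qed (use s in auto)
qed

text \<open>
  The condition \<open>\<phi> u \<noteq> 0\<close> has to exclude the homomorphisms that do not extend, and the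
  conclusion \<open>\<psi> v \<noteq> 0\<close> has the same form as the condition on \<open>u\<close>. This is what lets the lemma be
  iterated: the \<open>u\<close> found for one adjunction serves as the \<open>v\<close> for the adjunction below it.
  
  If \<open>x\<close> is transcendental over \<open>R\<close>, any \<open>\<xi>\<close> is admissible, and it only has to avoid the roots of
  the image of a polynomial \<open>p\<close> with \<open>v = p(x)\<close>; for \<open>u\<close> the leading coefficient of \<open>p\<close> serves. If
  \<open>x\<close> is algebraic, \<open>\<xi>\<close> has to be a root of the image of a polynomial \<open>m\<close> of least degree
  annihilating \<open>x\<close>. When the leading coefficient of \<open>m\<close> does not go to \<open>0\<close>, such a root exists, and
  pseudo-division by \<open>m\<close> shows that it satisfies all relations of \<open>x\<close>. As \<open>v\<close> divides a nonzero
  element \<open>c\<close> of \<open>R\<close>, it does not go to \<open>0\<close> if \<open>c\<close> does not.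
\<close>

lemma extend_hom_adjoin:
  fixes R :: "'f::field set"
  assumes "subring R" "v \<in> adjoin R x" "v \<noteq> 0"
  obtains u where "u \<in> R" "u \<noteq> 0"
    and "\<And>\<phi> :: 'f \<Rightarrow> 'w::alg_closed_field. subring_hom R \<phi> \<Longrightarrow> \<phi> u \<noteq> 0 \<Longrightarrow>
      \<exists>\<psi>. subring_hom (adjoin R x) \<psi> \<and> (\<forall>c\<in>R. \<psi> c = \<phi> c) \<and> \<psi> v \<noteq> 0"
proof -
  interpret subring R by fact
  obtain p where p: "p \<in> polys_over R" "v = poly p x"
    using assms(2) by (auto simp: adjoin_def)
  show thesis
  proof (cases "\<exists>m. m \<in> polys_over R \<and> m \<noteq> 0 \<and> poly m x = 0")
    case False
    show thesis
    proof (rule that)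
      show "lead_coeff p \<in> R" "lead_coeff p \<noteq> 0"
        using p assms(3) by (auto simp: coeff_polys_over)
    next
      fix \<phi> :: "'f \<Rightarrow> 'w" assume \<phi>: "subring_hom R \<phi>" "\<phi> (lead_coeff p) \<noteq> 0"
      interpret subring_hom R \<phi> by fact
      have "map_poly \<phi> p \<noteq> 0"
        using \<phi>(2) map_poly_hom_coeff by (metis coeff_0)
      then obtain \<xi> where \<xi>: "poly (map_poly \<phi> p) \<xi> \<noteq> 0"
        by (rule alg_closed_exists_non_root)
      show "\<exists>\<psi>. subring_hom (adjoin R x) \<psi> \<and> (\<forall>c\<in>R. \<psi> c = \<phi> c) \<and> \<psi> v \<noteq> 0"
        by (rule hom_extend_adjoin[of x \<xi>]) (use False p \<xi> in auto)
    qed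
  next
    case True
    then obtain m where m: "m \<in> polys_over R" "m \<noteq> 0" "poly m x = 0"
      and min: "\<And>q. q \<in> polys_over R \<Longrightarrow> q \<noteq> 0 \<Longrightarrow> poly q x = 0 \<Longrightarrow> degree m \<le> degree q"
      using ex_has_least_nat[of "\<lambda>m. m \<in> polys_over R \<and> m \<noteq> 0 \<and> poly m x = 0" _ degree]
      by blast
    obtain s c where sc: "s \<in> polys_over R" "c \<in> R" "c \<noteq> 0" "poly s x * poly p x = c"
      by (rule minimal_annihilator_invertible[OF assms(1) m _ p(1)]) (use min p(2) assms(3) in auto)
    show thesis
    proof (rule that)
      show "lead_coeff m * c \<in> R" "lead_coeff m * c \<noteq> 0"
        using m sc by (auto simp: coeff_polys_over mult_closed)
    next
      fix \<phi> :: "'f \<Rightarrow> 'w" assume \<phi>: "subring_hom R \<phi>" "\<phi> (lead_coeff m * c) \<noteq> 0"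
      interpret subring_hom R \<phi> by fact
      have nz: "\<phi> (lead_coeff m) \<noteq> 0" "\<phi> c \<noteq> 0"
        using \<phi>(2) m sc by (auto simp: hom_mult coeff_polys_over)
      have "degree m \<noteq> 0"
        using m by (metis degree_eq_zeroE pCons_0_0 poly_const_conv)
      moreover have "degree m \<le> degree (map_poly \<phi> m)"
        using nz by (intro le_degree) (simp add: map_poly_hom_coeff)
      ultimately obtain \<xi> where \<xi>: "poly (map_poly \<phi> m) \<xi> = 0"
        using alg_closed_imp_poly_has_root[of "map_poly \<phi> m"] by auto
      have "poly (map_poly \<phi> q) \<xi> = 0" if q: "q \<in> polys_over R" "poly q x = 0" for q
      proof -
        obtain k t r where tr: "t \<in> polys_over R" "r \<in> polys_over R"
          "smult (lead_coeff m ^ k) q = m * t + r" "r = 0 \<or> degree r < degree m"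
          using pseudo_division[OF m(1,2) q(1)] by metis
        have "poly r x = 0"
          using arg_cong[OF tr(3), of "\<lambda>q. poly q x"] m(3) q(2) by simp
        then have "r = 0"
          using min[of r] tr(2,4) by fastforce
        then have "map_poly \<phi> (smult (lead_coeff m ^ k) q) = map_poly \<phi> (m * t)"
          using tr(3) by simp
        then have "smult (\<phi> (lead_coeff m) ^ k) (map_poly \<phi> q) = map_poly \<phi> m * map_poly \<phi> t"
          using m(1) tr(1) q(1)
          by (simp add: map_poly_hom_smult map_poly_hom_mult hom_power power_closed coeff_polys_over)
        from arg_cong[OF this, of "\<lambda>q. poly q \<xi>"] show ?thesis
          using \<xi> nz by simp
      qed
      then obtain \<psi> where \<psi>: "subring_hom (adjoin R x) \<psi>" "\<And>c. c \<in> R \<Longrightarrow> \<psi> c = \<phi> c"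
        using hom_extend_adjoin[of x \<xi>] by (metis (no_types))
      interpret S: subring_hom "adjoin R x" \<psi> by fact
      have "\<psi> (poly s x) * \<psi> v = \<phi> c"
        using S.hom_mult[of "poly s x" v] sc p \<psi>(2)[of c] by (simp add: adjoin_def)
      then have "\<psi> v \<noteq> 0"
        using nz by auto
      then show "\<exists>\<psi>. subring_hom (adjoin R x) \<psi> \<and> (\<forall>c\<in>R. \<psi> c = \<phi> c) \<and> \<psi> v \<noteq> 0"
        using \<psi> by blast
    qed
  qed
qed

section \<open>Specialization of finitely many elements\<close>

text \<open>
  One element is adjoined after the other; the condition of not sending a certain element to \<open>0\<close> is
  pulled down from each ring to the one below.
\<close>

lemma extend_hom_adjoin_finite:
  fixes R :: "'f::field set"
  assumes "subring R" "finite X"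
  obtains S where "subring S" "R \<subseteq> S" "X \<subseteq> S"
    and "\<And>v. v \<in> S \<Longrightarrow> v \<noteq> 0 \<Longrightarrow> \<exists>u\<in>R. u \<noteq> 0 \<and>
      (\<forall>\<phi> :: 'f \<Rightarrow> 'w::alg_closed_field. subring_hom R \<phi> \<longrightarrow> \<phi> u \<noteq> 0 \<longrightarrow>
        (\<exists>\<psi>. subring_hom S \<psi> \<and> (\<forall>c\<in>R. \<psi> c = \<phi> c) \<and> \<psi> v \<noteq> 0))"
  using assms(2)
proof (induction arbitrary: thesis rule: finite_induct)
  case empty
  show ?case
    by (rule empty[of R]) (use assms(1) in auto)
next
  case (insert x X)
  obtain S where S: "subring S" "R \<subseteq> S" "X \<subseteq> S"
    and ext: "\<And>v. v \<in> S \<Longrightarrow> v \<noteq> 0 \<Longrightarrow> \<exists>u\<in>R. u \<noteq> 0 \<and>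
      (\<forall>\<phi> :: 'f \<Rightarrow> 'w. subring_hom R \<phi> \<longrightarrow> \<phi> u \<noteq> 0 \<longrightarrow>
        (\<exists>\<psi>. subring_hom S \<psi> \<and> (\<forall>c\<in>R. \<psi> c = \<phi> c) \<and> \<psi> v \<noteq> 0))"
    by (rule insert.IH) blast
  interpret subring S by fact
  show ?case
  proof (rule insert.prems)
    show "subring (adjoin S x)"
      by (rule subring_adjoin)
    show "R \<subseteq> adjoin S x" "insert x X \<subseteq> adjoin S x"
      using S(2,3) subset_adjoin[of x] mem_adjoin[of x] by auto
  next
    fix v assume v: "v \<in> adjoin S x" "v \<noteq> 0"
    obtain w where w: "w \<in> S" "w \<noteq> 0"
      and top: "\<And>\<phi> :: 'f \<Rightarrow> 'w. subring_hom S \<phi> \<Longrightarrow> \<phi> w \<noteq> 0 \<Longrightarrow>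
        \<exists>\<psi>. subring_hom (adjoin S x) \<psi> \<and> (\<forall>c\<in>S. \<psi> c = \<phi> c) \<and> \<psi> v \<noteq> 0"
      using extend_hom_adjoin[OF S(1) v] by metis
    obtain u where u: "u \<in> R" "u \<noteq> 0"
      and bot: "\<And>\<phi> :: 'f \<Rightarrow> 'w. subring_hom R \<phi> \<Longrightarrow> \<phi> u \<noteq> 0 \<Longrightarrow>
        \<exists>\<psi>. subring_hom S \<psi> \<and> (\<forall>c\<in>R. \<psi> c = \<phi> c) \<and> \<psi> w \<noteq> 0"
      using ext[OF w] by blast
    have "\<exists>\<psi>. subring_hom (adjoin S x) \<psi> \<and> (\<forall>c\<in>R. \<psi> c = \<phi> c) \<and> \<psi> v \<noteq> 0"
      if \<phi>: "subring_hom R \<phi>" "\<phi> u \<noteq> 0" for \<phi> :: "'f \<Rightarrow> 'w"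
    proof -
      obtain \<chi> where \<chi>: "subring_hom S \<chi>" "\<forall>c\<in>R. \<chi> c = \<phi> c" "\<chi> w \<noteq> 0"
        using bot[OF \<phi>] by blast
      obtain \<psi> where "subring_hom (adjoin S x) \<psi>" "\<forall>c\<in>S. \<psi> c = \<chi> c" "\<psi> v \<noteq> 0"
        using top[OF \<chi>(1,3)] by blast
      with \<chi>(2) S(2) show ?thesis
        by (intro exI[of _ \<psi>]) auto
    qed
    with u show "\<exists>u\<in>R. u \<noteq> 0 \<and>
      (\<forall>\<phi> :: 'f \<Rightarrow> 'w. subring_hom R \<phi> \<longrightarrow> \<phi> u \<noteq> 0 \<longrightarrow>
        (\<exists>\<psi>. subring_hom (adjoin S x) \<psi> \<and> (\<forall>c\<in>R. \<psi> c = \<phi> c) \<and> \<psi> v \<noteq> 0))"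
      by blast
  qed
qed

context field_embedding
begin

lemma hom_zero: "\<iota> 0 = 0"
  by (metis add_0 add_cancel_right_right hom_add)

lemma hom_diff: "\<iota> (c - d) = \<iota> c - \<iota> d"
  using hom_add[of "c - d" d] by (simp add: algebra_simps)

lemma subring_range: "subring (range \<iota>)"
proof
  show "1 \<in> range \<iota>"
    by (rule range_eqI[of _ _ 1]) (simp add: hom_one)
next
  fix c d assume "c \<in> range \<iota>" "d \<in> range \<iota>"
  then show "c - d \<in> range \<iota>" "c * d \<in> range \<iota>"
    by (auto simp flip: hom_diff hom_mult)
qed

end

text \<open>
  The previous lemma is applied to \<open>R = K\<close> and \<open>v = 1\<close>. The resulting condition on \<open>u\<close> is then
  automatic, because a homomorphism of fields sends only \<open>0\<close> to \<open>0\<close>.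
  
  This is the Nullstellensatz in a form without ideals: a finite system of polynomial equations
  over \<open>K\<close> that can be solved in the first field can be solved in the second one, since \<open>\<psi>\<close> carries
  a solution to a solution.
\<close>

lemma specialization_to_alg_closed:
  fixes \<iota>\<^sub>1 :: "'k::field \<Rightarrow> 'f::field" and \<iota>\<^sub>2 :: "'k \<Rightarrow> 'w::alg_closed_field"
  assumes "field_embedding \<iota>\<^sub>1" "field_embedding \<iota>\<^sub>2" "finite X"
  obtains S \<psi> where "subring_hom S \<psi>" "X \<subseteq> S" "range \<iota>\<^sub>1 \<subseteq> S" "\<And>c. \<psi> (\<iota>\<^sub>1 c) = \<iota>\<^sub>2 c"
proof -
  interpret e1: field_embedding \<iota>\<^sub>1 by fact
  interpret e2: field_embedding \<iota>\<^sub>2 by fact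
  define \<phi> where "\<phi> = \<iota>\<^sub>2 \<circ> inv \<iota>\<^sub>1"
  have \<phi>: "\<phi> (\<iota>\<^sub>1 c) = \<iota>\<^sub>2 c" for c
    by (simp add: \<phi>_def e1.hom_inj)
  interpret R: subring "range \<iota>\<^sub>1"
    by (rule e1.subring_range)
  have "subring_hom (range \<iota>\<^sub>1) \<phi>"
  proof
    show "\<phi> 1 = 1"
      using \<phi>[of 1] by (simp add: e1.hom_one e2.hom_one)
  next
    fix c d assume "c \<in> range \<iota>\<^sub>1" "d \<in> range \<iota>\<^sub>1"
    then show "\<phi> (c + d) = \<phi> c + \<phi> d" "\<phi> (c * d) = \<phi> c * \<phi> d"
      by (auto simp: \<phi> e2.hom_add e2.hom_mult simp flip: e1.hom_add e1.hom_mult)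
  qed
  obtain S where S: "subring S" "range \<iota>\<^sub>1 \<subseteq> S" "X \<subseteq> S"
    and ext: "\<And>v. v \<in> S \<Longrightarrow> v \<noteq> 0 \<Longrightarrow> \<exists>u\<in>range \<iota>\<^sub>1. u \<noteq> 0 \<and>
      (\<forall>\<phi> :: 'f \<Rightarrow> 'w. subring_hom (range \<iota>\<^sub>1) \<phi> \<longrightarrow> \<phi> u \<noteq> 0 \<longrightarrow>
        (\<exists>\<psi>. subring_hom S \<psi> \<and> (\<forall>c\<in>range \<iota>\<^sub>1. \<psi> c = \<phi> c) \<and> \<psi> v \<noteq> 0))"
    using extend_hom_adjoin_finite[OF R.subring_axioms assms(3)] by metis
  obtain u where u: "u \<in> range \<iota>\<^sub>1" "u \<noteq> 0"
    and u_ext: "\<phi> u \<noteq> 0 \<Longrightarrow> \<exists>\<psi>. subring_hom S \<psi> \<and> (\<forall>c\<in>range \<iota>\<^sub>1. \<psi> c = \<phi> c)"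
    using ext[OF subring.one_closed[OF S(1)] one_neq_zero] \<open>subring_hom (range \<iota>\<^sub>1) \<phi>\<close> by blast
  from u obtain c where "u = \<iota>\<^sub>1 c" "c \<noteq> 0"
    using e1.hom_zero by auto
  then have "\<phi> u \<noteq> 0"
    using injD[OF e2.hom_inj, of c 0] by (auto simp: \<phi> e2.hom_zero)
  then obtain \<psi> where \<psi>: "subring_hom S \<psi>" "\<forall>c\<in>range \<iota>\<^sub>1. \<psi> c = \<phi> c"
    using u_ext by blast
  show thesis
    by (rule that[OF \<psi>(1) S(3,2)]) (use \<psi>(2) \<phi> in simp)
qed

section \<open>Isomorphism of algebras with a carrier\<close>

definition closed_alg :: "('f, 'v) alg \<Rightarrow> bool" where
  "closed_alg V \<longleftrightarrow>
     (\<forall>x\<in>carrier V. \<forall>y\<in>carrier V. add V x y \<in> carrier V \<and> mult V x y \<in> carrier V) \<and>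
     (\<forall>z. \<forall>x\<in>carrier V. alg.smult V z x \<in> carrier V)"

lemma alg_isoD:
  assumes "h \<in> alg_iso V W"
  shows "bij_betw h (carrier V) (carrier W)"
    and "x \<in> carrier V \<Longrightarrow> h x \<in> carrier W"
    and "x \<in> carrier V \<Longrightarrow> y \<in> carrier V \<Longrightarrow> h (add V x y) = add W (h x) (h y)"
    and "x \<in> carrier V \<Longrightarrow> y \<in> carrier V \<Longrightarrow> h (mult V x y) = mult W (h x) (h y)"
    and "x \<in> carrier V \<Longrightarrow> h (alg.smult V z x) = alg.smult W z (h x)"
  using assms by (auto simp: alg_iso_def bij_betw_apply)

lemma alg_iso_comp: "g \<in> alg_iso V W \<Longrightarrow> h \<in> alg_iso U V \<Longrightarrow> g \<circ> h \<in> alg_iso U W"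
  by (auto simp: alg_iso_def bij_betw_apply intro: bij_betw_trans)

text \<open>
  That the inverse of \<open>h\<close> preserves the operations is seen by applying it to an operation performed
  in \<open>V\<close>; it is a left inverse there only on the carrier, so the carrier has to be closed.
\<close>

lemma alg_iso_inv_into:
  assumes "closed_alg V" "h \<in> alg_iso V W"
  shows "inv_into (carrier V) h \<in> alg_iso W V"
proof -
  note h = alg_isoD[OF assms(2)]
  let ?g = "inv_into (carrier V) h"
  have bij: "bij_betw ?g (carrier W) (carrier V)"
    by (rule bij_betw_inv_into[OF h(1)])
  have g: "?g y \<in> carrier V" "h (?g y) = y" if "y \<in> carrier W" for y
    using that h(1) bij by (auto simp: bij_betw_apply bij_betw_inv_into_right)
  have gh: "?g (h x) = x" if "x \<in> carrier V" for x
    by (rule bij_betw_inv_into_left[OF h(1) that])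
  have closed: "add V x y \<in> carrier V" "mult V x y \<in> carrier V" "alg.smult V z x \<in> carrier V"
    if "x \<in> carrier V" "y \<in> carrier V" for x y z
    using assms(1) that by (auto simp: closed_alg_def)
  show ?thesis
    unfolding alg_iso_def
  proof (intro CollectI conjI ballI allI bij)
    fix x y assume xy: "x \<in> carrier W" "y \<in> carrier W"
    show "?g (add W x y) = add V (?g x) (?g y)"
      using gh[OF closed(1)[OF g(1)[OF xy(1)] g(1)[OF xy(2)]]] by (simp add: h(3) g xy)
    show "?g (mult W x y) = mult V (?g x) (?g y)"
      using gh[OF closed(2)[OF g(1)[OF xy(1)] g(1)[OF xy(2)]]] by (simp add: h(4) g xy)
  next
    fix z x assume x: "x \<in> carrier W"
    show "?g (alg.smult W z x) = alg.smult V z (?g x)"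
      using gh[OF closed(3)[OF g(1)[OF x] g(1)[OF x]]] by (simp add: h(5) g x)
  qed
qed

lemma alg_isomorphic_sym: "closed_alg V \<Longrightarrow> V \<cong>\<^sub>a W \<Longrightarrow> W \<cong>\<^sub>a V"
  using alg_iso_inv_into by (fastforce simp: alg_isomorphic_def)

lemma alg_isomorphic_trans: "U \<cong>\<^sub>a V \<Longrightarrow> V \<cong>\<^sub>a W \<Longrightarrow> U \<cong>\<^sub>a W"
  using alg_iso_comp by (fastforce simp: alg_isomorphic_def)

section \<open>Algebras given by structure constants\<close>

text \<open>
  The algebra of coordinate vectors over the basis \<open>B\<close>, in which \<open>\<gamma> a b e\<close> is the coefficient of
  \<open>e\<close> in the product of \<open>a\<close> and \<open>b\<close>. Coordinate vectors vanish outside \<open>B\<close>, so that equality of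
  vectors is equality of functions.
\<close>

definition structure_alg :: "'a set \<Rightarrow> ('a \<Rightarrow> 'a \<Rightarrow> 'a \<Rightarrow> 'f) \<Rightarrow> ('f::comm_ring_1, 'a \<Rightarrow> 'f) alg" where
  "structure_alg B \<gamma> =
     \<lparr>carrier = {f. \<forall>e. e \<notin> B \<longrightarrow> f e = 0},
      add = (\<lambda>f g e. f e + g e),
      mult = (\<lambda>f g e. if e \<in> B then \<Sum>a\<in>B. \<Sum>b\<in>B. f a * g b * \<gamma> a b e else 0),
      smult = (\<lambda>z f e. z * f e)\<rparr>"

definition unit_vec :: "'a \<Rightarrow> 'a \<Rightarrow> 'f::comm_ring_1" where
  "unit_vec a = (\<lambda>e. if e = a then 1 else 0)"

lemma closed_structure_alg: "closed_alg (structure_alg B \<gamma>)"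
  by (auto simp: closed_alg_def structure_alg_def)

lemma unit_vec_carrier: "a \<in> B \<Longrightarrow> unit_vec a \<in> carrier (structure_alg B \<gamma>)"
  by (auto simp: structure_alg_def unit_vec_def)

lemma mult_unit_vec:
  assumes "finite B" "a \<in> B" "b \<in> B" "e \<in> B"
  shows "mult (structure_alg B \<gamma>) (unit_vec a) (unit_vec b) e = \<gamma> a b e"
proof -
  have "mult (structure_alg B \<gamma>) (unit_vec a) (unit_vec b) e =
      (\<Sum>a'\<in>B. if a' = a then \<Sum>b'\<in>B. if b' = b then \<gamma> a' b' e else 0 else 0)"
    using assms(4) by (auto simp: structure_alg_def unit_vec_def intro!: sum.cong)
  then show ?thesis
    using assms(1-3) by simp
qed

text \<open>
  An isomorphism is linear, so it is multiplication by the matrix whose columns are the images of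
  the basis vectors. The proof adds the coordinates of \<open>f\<close> one by one.
\<close>

lemma structure_alg_iso_matrix:
  assumes "finite A" "h \<in> alg_iso (structure_alg A \<gamma>) (structure_alg B \<delta>)"
    and "f \<in> carrier (structure_alg A \<gamma>)"
  shows "h f b = (\<Sum>a\<in>A. h (unit_vec a) b * f a)"
proof -
  let ?V = "structure_alg A \<gamma>" and ?W = "structure_alg B \<delta>"
  note h = alg_isoD[OF assms(2)]
  have "h (\<lambda>e. if e \<in> J then f e else 0) b = (\<Sum>a\<in>J. h (unit_vec a) b * f a)" if "J \<subseteq> A" for J
    using finite_subset[OF that assms(1)] that
  proof (induction J rule: finite_induct)
    case empty
    have "(\<lambda>e. 0) \<in> carrier ?V"
      by (simp add: structure_alg_def)
    from h(5)[OF this, of 0] show ?case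
      by (simp add: structure_alg_def)
  next
    case (insert j J)
    let ?f = "\<lambda>e. if e \<in> J then f e else 0"
    have j: "unit_vec j \<in> carrier ?V"
      using insert.prems by (simp add: unit_vec_carrier)
    have 1: "alg.smult ?V (f j) (unit_vec j) \<in> carrier ?V" "?f \<in> carrier ?V"
      using insert.prems by (auto simp: structure_alg_def unit_vec_def)
    have "(\<lambda>e. if e \<in> insert j J then f e else 0) = add ?V (alg.smult ?V (f j) (unit_vec j)) ?f"
      using insert.hyps by (auto simp: structure_alg_def unit_vec_def)
    then have "h (\<lambda>e. if e \<in> insert j J then f e else 0) =
        add ?W (alg.smult ?W (f j) (h (unit_vec j))) (h ?f)"
      by (simp only: h(3)[OF 1] h(5)[OF j])
    then show ?case
      using insert by (simp add: structure_alg_def mult.commute)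
  qed
  moreover have "(\<lambda>e. if e \<in> A then f e else 0) = f"
    using assms(3) by (auto simp: structure_alg_def)
  ultimately show ?thesis
    by (metis order_refl)
qed

section \<open>Isomorphisms as solutions of polynomial equations\<close>

text \<open>
  \<open>P\<close> is the matrix of a linear map between the algebras with structure constants \<open>\<gamma>\<close> and \<open>\<delta>\<close>, and
  \<open>Q\<close> is the inverse matrix. The last equation says that \<open>P\<close> is multiplicative on pairs of basis
  vectors. Carrying along \<open>Q\<close> expresses invertibility by equations alone, and equations, unlike
  inequations, are preserved by every ring homomorphism.
\<close>

definition iso_matrices ::
    "'a set \<Rightarrow> 'b set \<Rightarrow> ('a \<Rightarrow> 'a \<Rightarrow> 'a \<Rightarrow> 'f) \<Rightarrow> ('b \<Rightarrow> 'b \<Rightarrow> 'b \<Rightarrow> 'f) \<Rightarrow>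
     ('b \<Rightarrow> 'a \<Rightarrow> 'f) \<Rightarrow> ('a \<Rightarrow> 'b \<Rightarrow> 'f::comm_ring_1) \<Rightarrow> bool" where
  "iso_matrices A B \<gamma> \<delta> P Q \<longleftrightarrow>
     (\<forall>a\<in>A. \<forall>a'\<in>A. (\<Sum>b\<in>B. Q a b * P b a') = (if a = a' then 1 else 0)) \<and>
     (\<forall>b\<in>B. \<forall>b'\<in>B. (\<Sum>a\<in>A. P b a * Q a b') = (if b = b' then 1 else 0)) \<and>
     (\<forall>a\<in>A. \<forall>a'\<in>A. \<forall>b\<in>B. (\<Sum>e\<in>A. P b e * \<gamma> a a' e) =
        (\<Sum>c\<in>B. \<Sum>c'\<in>B. P c a * P c' a' * \<delta> c c' b))"

lemma iso_matrices_of_isomorphic: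
  assumes fin: "finite A" "finite B"
    and "structure_alg A \<gamma> \<cong>\<^sub>a structure_alg B \<delta>"
  shows "\<exists>P Q. iso_matrices A B \<gamma> \<delta> P Q"
proof -
  let ?V = "structure_alg A \<gamma>" and ?W = "structure_alg B \<delta>"
  obtain h where h_iso: "h \<in> alg_iso ?V ?W"
    using assms(3) by (auto simp: alg_isomorphic_def)
  define g where "g = inv_into (carrier ?V) h"
  have g_iso: "g \<in> alg_iso ?W ?V"
    unfolding g_def by (rule alg_iso_inv_into[OF closed_structure_alg h_iso])
  note h = alg_isoD[OF h_iso] and g = alg_isoD[OF g_iso]
  note h_mat = structure_alg_iso_matrix[OF fin(1) h_iso]
    and g_mat = structure_alg_iso_matrix[OF fin(2) g_iso]
  have gh: "g (h f) = f" if "f \<in> carrier ?V" for f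
    unfolding g_def by (rule bij_betw_inv_into_left[OF h(1) that])
  have hg: "h (g f) = f" if "f \<in> carrier ?W" for f
    unfolding g_def by (rule bij_betw_inv_into_right[OF h(1) that])
  have "iso_matrices A B \<gamma> \<delta> (\<lambda>b a. h (unit_vec a) b) (\<lambda>a b. g (unit_vec b) a)"
    unfolding iso_matrices_def
  proof (intro conjI ballI)
    fix a a' assume "a \<in> A" "a' \<in> A"
    then have a': "unit_vec a' \<in> carrier ?V"
      by (simp add: unit_vec_carrier)
    show "(\<Sum>b\<in>B. g (unit_vec b) a * h (unit_vec a') b) = (if a = a' then 1 else 0)"
      using g_mat[OF h(2)[OF a'], of a] gh[OF a'] by (simp add: unit_vec_def)
  next
    fix b b' assume "b \<in> B" "b' \<in> B"
    then have b': "unit_vec b' \<in> carrier ?W"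
      by (simp add: unit_vec_carrier)
    show "(\<Sum>a\<in>A. h (unit_vec a) b * g (unit_vec b') a) = (if b = b' then 1 else 0)"
      using h_mat[OF g(2)[OF b'], of b] hg[OF b'] by (simp add: unit_vec_def)
  next
    fix a a' b assume a: "a \<in> A" "a' \<in> A" and b: "b \<in> B"
    let ?m = "mult ?V (unit_vec a) (unit_vec a')"
    have carr: "unit_vec a \<in> carrier ?V" "unit_vec a' \<in> carrier ?V"
      using a by (simp_all add: unit_vec_carrier)
    then have "?m \<in> carrier ?V"
      using closed_structure_alg[of A \<gamma>] by (simp add: closed_alg_def)
    then have "(\<Sum>e\<in>A. h (unit_vec e) b * \<gamma> a a' e) = h ?m b"
      using a fin(1) by (simp add: h_mat mult_unit_vec)
    also have "\<dots> = mult ?W (h (unit_vec a)) (h (unit_vec a')) b"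
      by (simp add: h(4)[OF carr])
    also have "\<dots> = (\<Sum>c\<in>B. \<Sum>c'\<in>B. h (unit_vec a) c * h (unit_vec a') c' * \<delta> c c' b)"
      using b by (simp add: structure_alg_def)
    finally show "(\<Sum>e\<in>A. h (unit_vec e) b * \<gamma> a a' e) =
        (\<Sum>c\<in>B. \<Sum>c'\<in>B. h (unit_vec a) c * h (unit_vec a') c' * \<delta> c c' b)" .
  qed
  then show ?thesis
    by blast
qed

lemma sum_inverse_matrices:
  fixes f :: "'a \<Rightarrow> 'f::comm_ring_1"
  assumes "finite A" "a \<in> A"
    and "\<And>a'. a' \<in> A \<Longrightarrow> (\<Sum>b\<in>B. Q a b * P b a') = (if a = a' then 1 else 0)"
  shows "(\<Sum>b\<in>B. Q a b * (\<Sum>a'\<in>A. P b a' * f a')) = f a"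
proof -
  have "(\<Sum>b\<in>B. Q a b * (\<Sum>a'\<in>A. P b a' * f a')) = (\<Sum>b\<in>B. \<Sum>a'\<in>A. Q a b * P b a' * f a')"
    by (simp add: sum_distrib_left mult.assoc)
  also have "\<dots> = (\<Sum>a'\<in>A. \<Sum>b\<in>B. Q a b * P b a' * f a')"
    by (rule sum.swap)
  also have "\<dots> = (\<Sum>a'\<in>A. (\<Sum>b\<in>B. Q a b * P b a') * f a')"
    by (simp add: sum_distrib_right)
  also have "\<dots> = (\<Sum>a'\<in>A. if a' = a then f a' else 0)"
    using assms(3) by (intro sum.cong) auto
  finally show ?thesis
    using assms(1,2) by simp
qed

lemma isomorphic_of_iso_matrices:
  assumes fin: "finite A" "finite B" and PQ: "iso_matrices A B \<gamma> \<delta> P Q"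
  shows "structure_alg A \<gamma> \<cong>\<^sub>a structure_alg B \<delta>"
proof -
  let ?V = "structure_alg A \<gamma>" and ?W = "structure_alg B \<delta>"
  define h where "h f = (\<lambda>b. if b \<in> B then \<Sum>a\<in>A. P b a * f a else 0)" for f
  define g where "g f = (\<lambda>a. if a \<in> A then \<Sum>b\<in>B. Q a b * f b else 0)" for f
  have gh: "g (h f) = f" if "f \<in> carrier ?V" for f
  proof
    show "g (h f) a = f a" for a
      using that sum_inverse_matrices[of A a Q P B f] PQ fin
      by (cases "a \<in> A") (auto simp: g_def h_def iso_matrices_def structure_alg_def)
  qed
  have hg: "h (g f) = f" if "f \<in> carrier ?W" for f
  proof
    show "h (g f) b = f b" for b
      using that sum_inverse_matrices[of B b P Q A f] PQ fin
      by (cases "b \<in> B") (auto simp: g_def h_def iso_matrices_def structure_alg_def)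
  qed
  have "h \<in> alg_iso ?V ?W"
    unfolding alg_iso_def
  proof (intro CollectI conjI ballI allI)
    show "bij_betw h (carrier ?V) (carrier ?W)"
      by (rule bij_betw_byWitness[where f' = g])
        (use gh hg in \<open>auto simp: g_def h_def structure_alg_def\<close>)
  next
    fix f f' assume "f \<in> carrier ?V" "f' \<in> carrier ?V"
    show "h (add ?V f f') = add ?W (h f) (h f')"
      by (auto simp: h_def structure_alg_def distrib_left sum.distrib)
    show "h (mult ?V f f') = mult ?W (h f) (h f')"
    proof
      fix b
      show "h (mult ?V f f') b = mult ?W (h f) (h f') b"
      proof (cases "b \<in> B")
        case True
        have "h (mult ?V f f') b = (\<Sum>e\<in>A. \<Sum>a\<in>A. \<Sum>a'\<in>A. f a * f' a' * (P b e * \<gamma> a a' e))"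
          using True by (simp add: h_def structure_alg_def sum_distrib_left mult_ac)
        also have "\<dots> = (\<Sum>a\<in>A. \<Sum>e\<in>A. \<Sum>a'\<in>A. f a * f' a' * (P b e * \<gamma> a a' e))"
          by (rule sum.swap)
        also have "\<dots> = (\<Sum>a\<in>A. \<Sum>a'\<in>A. \<Sum>e\<in>A. f a * f' a' * (P b e * \<gamma> a a' e))"
          by (intro sum.cong refl sum.swap)
        also have "\<dots> = (\<Sum>a\<in>A. \<Sum>a'\<in>A. f a * f' a' * (\<Sum>e\<in>A. P b e * \<gamma> a a' e))"
          by (simp add: sum_distrib_left)
        also have "\<dots> = (\<Sum>a\<in>A. \<Sum>a'\<in>A. f a * f' a' * (\<Sum>c\<in>B. \<Sum>c'\<in>B. P c a * P c' a' * \<delta> c c' b))"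
          using PQ True by (intro sum.cong) (auto simp: iso_matrices_def)
        \<comment> \<open>Two double sums are interchanged at once as sums over pairs.\<close>
        also have "\<dots> = (\<Sum>(a, a')\<in>A \<times> A. \<Sum>(c, c')\<in>B \<times> B.
            f a * f' a' * (P c a * P c' a' * \<delta> c c' b))"
          by (simp add: sum.cartesian_product[symmetric] sum_distrib_left)
        also have "\<dots> = (\<Sum>(c, c')\<in>B \<times> B. \<Sum>(a, a')\<in>A \<times> A.
            f a * f' a' * (P c a * P c' a' * \<delta> c c' b))"
          unfolding case_prod_beta by (rule sum.swap)
        also have "\<dots> = (\<Sum>c\<in>B. \<Sum>c'\<in>B. \<Sum>a\<in>A. \<Sum>a'\<in>A. P c a * f a * (P c' a' * f' a') * \<delta> c c' b)"
          by (simp add: sum.cartesian_product[symmetric] mult_ac)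
        also have "\<dots> = (\<Sum>c\<in>B. \<Sum>c'\<in>B. (\<Sum>a\<in>A. P c a * f a) * (\<Sum>a'\<in>A. P c' a' * f' a') * \<delta> c c' b)"
          unfolding sum_product by (simp only: sum_distrib_right)
        also have "\<dots> = mult ?W (h f) (h f') b"
          using True by (simp add: h_def structure_alg_def)
        finally show ?thesis .
      qed (simp add: h_def structure_alg_def)
    qed
  next
    fix z f assume "f \<in> carrier ?V"
    show "h (alg.smult ?V z f) = alg.smult ?W z (h f)"
      by (auto simp: h_def structure_alg_def sum_distrib_left mult_ac)
  qed
  then show ?thesis
    by (auto simp: alg_isomorphic_def)
qed

lemma (in subring_hom) iso_matrices_hom:
  assumes PQ: "iso_matrices A B \<gamma> \<delta> P Q"
    and P: "\<And>b a. b \<in> B \<Longrightarrow> a \<in> A \<Longrightarrow> P b a \<in> R"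
    and Q: "\<And>a b. a \<in> A \<Longrightarrow> b \<in> B \<Longrightarrow> Q a b \<in> R"
    and \<gamma>: "\<And>a a' e. \<gamma> a a' e \<in> R" and \<delta>: "\<And>b b' e. \<delta> b b' e \<in> R"
  shows "iso_matrices A B (\<lambda>a a' e. \<phi> (\<gamma> a a' e)) (\<lambda>b b' e. \<phi> (\<delta> b b' e))
           (\<lambda>b a. \<phi> (P b a)) (\<lambda>a b. \<phi> (Q a b))"
  unfolding iso_matrices_def
proof (intro conjI ballI)
  fix a a' assume a: "a \<in> A" "a' \<in> A"
  have "\<phi> (\<Sum>b\<in>B. Q a b * P b a') = \<phi> (if a = a' then 1 else 0)"
    using PQ a by (simp add: iso_matrices_def)
  then show "(\<Sum>b\<in>B. \<phi> (Q a b) * \<phi> (P b a')) = (if a = a' then 1 else 0)"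
    using P Q a by (simp add: hom_sum hom_mult mult_closed hom_one hom_zero split: if_splits)
next
  fix b b' assume b: "b \<in> B" "b' \<in> B"
  have "\<phi> (\<Sum>a\<in>A. P b a * Q a b') = \<phi> (if b = b' then 1 else 0)"
    using PQ b by (simp add: iso_matrices_def)
  then show "(\<Sum>a\<in>A. \<phi> (P b a) * \<phi> (Q a b')) = (if b = b' then 1 else 0)"
    using P Q b by (simp add: hom_sum hom_mult mult_closed hom_one hom_zero split: if_splits)
next
  fix a a' b assume a: "a \<in> A" "a' \<in> A" and b: "b \<in> B"
  have "\<phi> (\<Sum>e\<in>A. P b e * \<gamma> a a' e) = \<phi> (\<Sum>c\<in>B. \<Sum>c'\<in>B. P c a * P c' a' * \<delta> c c' b)"
    using PQ a b by (simp add: iso_matrices_def)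
  then show "(\<Sum>e\<in>A. \<phi> (P b e) * \<phi> (\<gamma> a a' e)) =
      (\<Sum>c\<in>B. \<Sum>c'\<in>B. \<phi> (P c a) * \<phi> (P c' a') * \<phi> (\<delta> c c' b))"
    using P a b \<gamma> \<delta> by (simp add: hom_sum hom_mult mult_closed sum_closed)
qed

section \<open>Coordinates on the scalar extension\<close>

text \<open>
  The additive extension of \<open>g\<close> to formal sums. In contrast to \<^const>\<open>frag_extend\<close>, its values lie
  in a ring and not in another free abelian group.
\<close>

definition frag_eval :: "('i \<Rightarrow> 'f::comm_ring_1) \<Rightarrow> ('i \<Rightarrow>\<^sub>0 int) \<Rightarrow> 'f" where
  "frag_eval g u = (\<Sum>i\<in>Poly_Mapping.keys u. of_int (poly_mapping.lookup u i) * g i)"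

lemma frag_eval_superset:
  assumes "finite I" "Poly_Mapping.keys u \<subseteq> I"
  shows "frag_eval g u = (\<Sum>i\<in>I. of_int (poly_mapping.lookup u i) * g i)"
  unfolding frag_eval_def using assms
  by (intro sum.mono_neutral_left) (auto simp: in_keys_iff)

lemma frag_eval_of [simp]: "frag_eval g (frag_of i) = g i"
  by (simp add: frag_eval_def keys_frag_of)

lemma frag_eval_zero [simp]: "frag_eval g 0 = 0"
  by (simp add: frag_eval_def)

lemma frag_eval_diff: "frag_eval g (u - v) = frag_eval g u - frag_eval g v"
proof -
  let ?I = "Poly_Mapping.keys u \<union> Poly_Mapping.keys v"
  have "finite ?I" "Poly_Mapping.keys (u - v) \<subseteq> ?I"
    using keys_diff[of u v] by auto
  then show ?thesis
    by (simp add: frag_eval_superset[of ?I] lookup_minus left_diff_distrib sum_subtractf)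
qed

lemma frag_eval_add: "frag_eval g (u + v) = frag_eval g u + frag_eval g v"
  using frag_eval_diff[of g "u + v" v] by simp

lemma frag_eval_sum: "frag_eval g (sum w I) = (\<Sum>i\<in>I. frag_eval g (w i))"
  by (induction I rule: infinite_finite_induct) (auto simp: frag_eval_add)

text \<open>
  A basis of \<open>A\<close> is fixed independently of \<open>\<iota>\<close>, so that the same basis can be used for several
  extensions of \<open>K\<close>; the structure constants over an extension are then the images of those over
  \<open>K\<close>.
\<close>

locale extended_algebra =
  algebra_over scale mul + finite_dimensional_vector_space scale Basis + field_embedding \<iota>
  for scale :: "'k::field \<Rightarrow> 'a::ab_group_add \<Rightarrow> 'a" and mul Basis and \<iota> :: "'k \<Rightarrow> 'f::field"
begin

abbreviation rep :: "'a \<Rightarrow> 'a \<Rightarrow> 'k" where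
  "rep v e \<equiv> representation Basis v e"

text \<open>
  The formal sums that represent \<open>0\<close> in the tensor product.
\<close>

abbreviation tensor_null :: "('a \<times> 'f \<Rightarrow>\<^sub>0 int) set" where
  "tensor_null \<equiv> group_closure (tensor_relators \<iota> scale)"

text \<open>
  The coordinates of \<open>u\<close> with respect to the \<open>F\<close>-basis \<open>{e \<otimes> 1 | e \<in> Basis}\<close>, computed on formal sums.
\<close>

definition tensor_coord :: "('a \<times> 'f \<Rightarrow>\<^sub>0 int) \<Rightarrow> 'a \<Rightarrow> 'f" where
  "tensor_coord u e = frag_eval (\<lambda>(a, x). \<iota> (rep a e) * x) u"

definition structure_const :: "'a \<Rightarrow> 'a \<Rightarrow> 'a \<Rightarrow> 'f" where
  "structure_const a b e = \<iota> (rep (mul a b) e)"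

lemma rep_add: "rep (v + w) e = rep v e + rep w e"
  by (simp add: representation_add independent_Basis span_Basis)

lemma rep_scale: "rep (scale c v) e = c * rep v e"
  by (simp add: representation_scale independent_Basis span_Basis)

lemma rep_sum: "rep (sum g I) e = (\<Sum>i\<in>I. rep (g i) e)"
  by (simp add: representation_sum independent_Basis span_Basis)

lemma rep_outside: "e \<notin> Basis \<Longrightarrow> rep v e = 0"
  using representation_ne_zero by blast

lemma sum_rep: "(\<Sum>a\<in>Basis. scale (rep v a) a) = v"
  by (rule sum_representation_eq) (auto simp: independent_Basis span_Basis finite_Basis)

lemma hom_sum: "\<iota> (sum g I) = (\<Sum>i\<in>I. \<iota> (g i))"
  by (induction I rule: infinite_finite_induct) (auto simp: hom_zero hom_add)

lemma rep_mul: "rep (mul v w) e = (\<Sum>a\<in>Basis. \<Sum>b\<in>Basis. rep v a * rep w b * rep (mul a b) e)"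
proof -
  have left: "rep (mul v w) e = (\<Sum>a\<in>Basis. rep v a * rep (mul a w) e)" for v w
  proof -
    interpret m: Vector_Spaces.linear scale scale "\<lambda>v. mul v w"
      by (rule linear_mul_left)
    have "rep (mul v w) e = rep (mul (\<Sum>a\<in>Basis. scale (rep v a) a) w) e"
      by (simp only: sum_rep)
    also have "\<dots> = (\<Sum>a\<in>Basis. rep v a * rep (mul a w) e)"
      by (simp only: m.sum m.scale rep_sum rep_scale)
    finally show ?thesis .
  qed
  have right: "rep (mul a w) e = (\<Sum>b\<in>Basis. rep w b * rep (mul a b) e)" for a w
  proof -
    interpret m: Vector_Spaces.linear scale scale "\<lambda>w. mul a w"
      by (rule linear_mul_right)
    have "rep (mul a w) e = rep (mul a (\<Sum>b\<in>Basis. scale (rep w b) b)) e"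
      by (simp only: sum_rep)
    also have "\<dots> = (\<Sum>b\<in>Basis. rep w b * rep (mul a b) e)"
      by (simp only: m.sum m.scale rep_sum rep_scale)
    finally show ?thesis .
  qed
  have "rep (mul v w) e = (\<Sum>a\<in>Basis. rep v a * rep (mul a w) e)"
    by (rule left)
  also have "\<dots> = (\<Sum>a\<in>Basis. rep v a * (\<Sum>b\<in>Basis. rep w b * rep (mul a b) e))"
    by (intro sum.cong refl arg_cong2[where f = "(*)"] right)
  finally show ?thesis
    by (simp add: sum_distrib_left mult.assoc)
qed

lemma tensor_coord_of [simp]: "tensor_coord (frag_of (a, x)) e = \<iota> (rep a e) * x"
  by (simp add: tensor_coord_def)

lemma tensor_coord_zero [simp]: "tensor_coord 0 e = 0"
  by (simp add: tensor_coord_def)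

lemma tensor_coord_diff [simp]: "tensor_coord (u - v) e = tensor_coord u e - tensor_coord v e"
  by (simp add: tensor_coord_def frag_eval_diff)

lemma tensor_coord_add: "tensor_coord (u + v) e = tensor_coord u e + tensor_coord v e"
  by (simp add: tensor_coord_def frag_eval_add)

lemma tensor_coord_outside: "e \<notin> Basis \<Longrightarrow> tensor_coord u e = 0"
  by (simp add: tensor_coord_def frag_eval_def rep_outside hom_zero split_beta)

lemma tensor_coord_null:
  assumes "u \<in> tensor_null"
  shows "tensor_coord u e = 0"
  using assms
proof (induction rule: group_closure.induct)
  case (base s)
  then show ?case
    unfolding tensor_relators_def
    by (elim insertE UnE CollectE exE conjE)
      (simp_all only: tensor_coord_zero tensor_coord_diff tensor_coord_of rep_add rep_scale
        hom_add hom_mult, simp_all add: algebra_simps)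
qed simp

lemma tensor_null_add_left: "frag_of (a + b, x) - frag_of (a, x) - frag_of (b, x) \<in> tensor_null"
  by (rule tensor_relators_closure) (unfold tensor_relators_def, blast)

lemma tensor_null_add_right: "frag_of (a, x + y) - frag_of (a, x) - frag_of (a, y) \<in> tensor_null"
  by (rule tensor_relators_closure) (unfold tensor_relators_def, blast)

lemma tensor_null_scale: "frag_of (scale c a, x) - frag_of (a, \<iota> c * x) \<in> tensor_null"
  by (rule tensor_relators_closure) (unfold tensor_relators_def, blast)

lemma tensor_null_zero_left: "frag_of (0, x) \<in> tensor_null"
  using tensor_null_add_left[of 0 0 x] by simp

lemma tensor_null_zero_right: "frag_of (a, 0) \<in> tensor_null"
  using tensor_null_add_right[of a 0 0] by simp

lemma tensor_null_sum: "(\<And>i. i \<in> I \<Longrightarrow> g i \<in> tensor_null) \<Longrightarrow> sum g I \<in> tensor_null"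
  by (induction I rule: infinite_finite_induct) (simp_all add: group_closure_add)

lemma tensor_null_sum_left:
  assumes "finite I"
  shows "frag_of (\<Sum>i\<in>I. scale (c i) i, x) - (\<Sum>i\<in>I. frag_of (i, \<iota> (c i) * x)) \<in> tensor_null"
  using assms
proof (induction rule: finite_induct)
  case empty
  then show ?case
    by (simp add: tensor_null_zero_left)
next
  case (insert j I)
  let ?v = "\<Sum>i\<in>I. scale (c i) i"
  have "(frag_of (scale (c j) j + ?v, x) - frag_of (scale (c j) j, x) - frag_of (?v, x))
      + (frag_of (scale (c j) j, x) - frag_of (j, \<iota> (c j) * x))
      + (frag_of (?v, x) - (\<Sum>i\<in>I. frag_of (i, \<iota> (c i) * x))) \<in> tensor_null"
    by (intro group_closure_add tensor_null_add_left tensor_null_scale insert.IH)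
  then show ?case
    using insert.hyps by (simp add: algebra_simps)
qed

text \<open>
  Writing \<open>a\<close> in the basis and moving the coefficients across the tensor sign expresses \<open>a \<otimes> x\<close>
  through the \<open>e \<otimes> y\<close> with \<open>e\<close> in the basis. In particular, a tensor is determined by its
  coordinates.
\<close>

lemma tensor_normal_form:
  "u - (\<Sum>e\<in>Basis. frag_of (e, tensor_coord u e)) \<in> tensor_null"
  using subset_UNIV
proof (induction u rule: frag_induction)
  case zero
  show ?case
    using tensor_null_sum[of Basis "\<lambda>e. frag_of (e, 0)"]
    by (simp add: tensor_null_zero_right)
next
  case (one p)
  show ?case
    using tensor_null_sum_left[OF finite_Basis, of "rep (fst p)" "snd p"]
    by (cases p) (simp add: sum_rep)
next
  case (diff u v)
  let ?n = "\<lambda>w. \<Sum>e\<in>Basis. frag_of (e, tensor_coord w e)"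
  let ?d = "\<lambda>e. frag_of (e, tensor_coord u e) - frag_of (e, tensor_coord (u - v) e)
      - frag_of (e, tensor_coord v e)"
  have "?d e \<in> tensor_null" for e
    using tensor_null_add_right[of e "tensor_coord (u - v) e" "tensor_coord v e"] by simp
  then have "sum ?d Basis \<in> tensor_null"
    by (rule tensor_null_sum)
  then have "(u - ?n u) - (v - ?n v) + sum ?d Basis \<in> tensor_null"
    by (rule group_closure_add[OF group_closure.diff[OF diff]])
  also have "(u - ?n u) - (v - ?n v) + sum ?d Basis = (u - v) - ?n (u - v)"
    by (simp add: sum_subtractf)
  finally show ?case .
qed

lemma tensor_coord_eq_iff: "tensor_coord u = tensor_coord v \<longleftrightarrow> (u, v) \<in> tensor_rel \<iota> scale"
proof
  assume "tensor_coord u = tensor_coord v"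
  then have "(\<Sum>e\<in>Basis. frag_of (e, tensor_coord (u - v) e)) \<in> tensor_null"
    by (intro tensor_null_sum) (simp add: tensor_null_zero_right)
  with tensor_normal_form[of "u - v"] show "(u, v) \<in> tensor_rel \<iota> scale"
    using group_closure_add by (fastforce simp: tensor_rel_def)
next
  assume "(u, v) \<in> tensor_rel \<iota> scale"
  then have "tensor_coord (u - v) e = 0" for e
    by (intro tensor_coord_null) (simp add: tensor_rel_def)
  then show "tensor_coord u = tensor_coord v"
    by (auto simp: fun_eq_iff)
qed

lemma rep_Basis: "a \<in> Basis \<Longrightarrow> rep a e = (if e = a then 1 else 0)"
  using representation_basis[OF independent_Basis, of a] by (simp add: eq_commute)

lemma tensor_coord_surj:
  assumes "\<And>e. e \<notin> Basis \<Longrightarrow> f e = 0"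
  shows "tensor_coord (\<Sum>a\<in>Basis. frag_of (a, f a)) = f"
proof
  fix e
  have "tensor_coord (\<Sum>a\<in>Basis. frag_of (a, f a)) e = (\<Sum>a\<in>Basis. \<iota> (rep a e) * f a)"
    by (simp add: tensor_coord_def frag_eval_sum)
  also have "\<dots> = (\<Sum>a\<in>Basis. if a = e then f a else 0)"
    by (intro sum.cong) (auto simp: rep_Basis hom_zero hom_one)
  also have "\<dots> = f e"
    using assms finite_Basis by auto
  finally show "tensor_coord (\<Sum>a\<in>Basis. frag_of (a, f a)) e = f e" .
qed

lemma tensor_coord_smult: "tensor_coord (tensor_smult z u) e = z * tensor_coord u e"
  using subset_UNIV
proof (induction u rule: frag_induction)
  case (one p)
  show ?case
    by (cases p) (simp add: tensor_smult_def)
qed (simp_all add: tensor_smult_def frag_extend_diff right_diff_distrib)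

lemma tensor_coord_mult:
  "tensor_coord (tensor_mult mul u v) e =
     (\<Sum>a\<in>Basis. \<Sum>b\<in>Basis. tensor_coord u a * tensor_coord v b * structure_const a b e)"
  using subset_UNIV
proof (induction u rule: frag_induction)
  case (one p)
  show ?case
    using subset_UNIV
  proof (induction v rule: frag_induction)
    case zero
    show ?case
      using tensor_mult_diff_right[of mul "frag_of p" 0 0] by simp
  next
    case (one q)
    obtain a x b y where pq: "p = (a, x)" "q = (b, y)"
      by (cases p; cases q)
    have "tensor_coord (tensor_mult mul (frag_of p) (frag_of q)) e = \<iota> (rep (mul a b) e) * (x * y)"
      by (simp add: pq tensor_mult_def)
    also have "\<dots> = (\<Sum>c\<in>Basis. \<Sum>d\<in>Basis.
        \<iota> (rep a c) * \<iota> (rep b d) * structure_const c d e * (x * y))"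
      by (simp only: rep_mul[of a b e] structure_const_def hom_sum hom_mult sum_distrib_right)
    also have "\<dots> = (\<Sum>c\<in>Basis. \<Sum>d\<in>Basis.
        tensor_coord (frag_of p) c * tensor_coord (frag_of q) d * structure_const c d e)"
      by (intro sum.cong refl) (simp add: pq mult_ac)
    finally show ?case .
  next
    case (diff v w)
    then show ?case
      by (simp add: tensor_mult_diff_right ring_distribs sum_subtractf)
  qed
next
  case zero
  show ?case
    by (simp add: tensor_mult_def)
next
  case (diff u w)
  then show ?case
    by (simp add: tensor_mult_diff_left ring_distribs sum_subtractf)
qed

lemma scalar_extension_carrierD:
  "X \<in> carrier (scalar_extension \<iota> scale mul) \<Longrightarrow> \<exists>u. X = tensor_rel \<iota> scale `` {u}"
  unfolding scalar_extension_simps(1) by (erule quotientE) blast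

lemma scalar_extension_closed: "closed_alg (scalar_extension \<iota> scale mul)"
  unfolding closed_alg_def
proof (intro conjI ballI allI)
  let ?V = "scalar_extension \<iota> scale mul"
  fix X Y assume "X \<in> carrier ?V" "Y \<in> carrier ?V"
  then obtain u v where "X = tensor_rel \<iota> scale `` {u}" "Y = tensor_rel \<iota> scale `` {v}"
    using scalar_extension_carrierD by blast
  then show "add ?V X Y \<in> carrier ?V" "mult ?V X Y \<in> carrier ?V"
    by (simp_all add: scalar_extension_simps quotientI)
next
  let ?V = "scalar_extension \<iota> scale mul"
  fix z X assume "X \<in> carrier ?V"
  then obtain u where "X = tensor_rel \<iota> scale `` {u}"
    using scalar_extension_carrierD by blast
  then show "alg.smult ?V z X \<in> carrier ?V"
    by (simp add: scalar_extension_simps quotientI)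
qed

lemma scalar_extension_isomorphic_structure_alg:
  "scalar_extension \<iota> scale mul \<cong>\<^sub>a structure_alg Basis structure_const"
proof -
  let ?R = "tensor_rel \<iota> scale"
  let ?V = "scalar_extension \<iota> scale mul" and ?W = "structure_alg Basis structure_const"
  define h where "h X = the_elem (tensor_coord ` X)" for X
  have h: "h (?R `` {u}) = tensor_coord u" for u
  proof -
    have "tensor_coord ` (?R `` {u}) = {tensor_coord u}"
    proof -
      have "tensor_coord v = tensor_coord u" if "v \<in> ?R `` {u}" for v
        using that tensor_coord_eq_iff[of u v] by simp
      moreover have "u \<in> ?R `` {u}"
        by (rule equiv_class_self[OF equiv_tensor_rel UNIV_I])
      ultimately show ?thesis
        by blast
    qed
    then show ?thesis
      by (simp add: h_def)
  qed
  have "h \<in> alg_iso ?V ?W"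
    unfolding alg_iso_def
  proof (intro CollectI conjI ballI allI)
    have "inj_on h (carrier ?V)"
    proof (rule inj_onI)
      fix X Y assume "X \<in> carrier ?V" "Y \<in> carrier ?V" "h X = h Y"
      moreover from this obtain u v where "X = ?R `` {u}" "Y = ?R `` {v}"
        using scalar_extension_carrierD by blast
      ultimately show "X = Y"
        by (simp add: h tensor_coord_eq_iff equiv_class_eq[OF equiv_tensor_rel])
    qed
    moreover have "h ` carrier ?V = carrier ?W"
    proof (intro equalityI subsetI)
      fix f assume "f \<in> h ` carrier ?V"
      then obtain X where "X \<in> carrier ?V" "f = h X"
        by blast
      then obtain u where "f = tensor_coord u"
        using scalar_extension_carrierD h by blast
      then show "f \<in> carrier ?W"
        by (simp add: structure_alg_def tensor_coord_outside)
    next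
      fix f assume "f \<in> carrier ?W"
      then have "f = h (?R `` {\<Sum>a\<in>Basis. frag_of (a, f a)})"
        by (simp add: h tensor_coord_surj structure_alg_def)
      then show "f \<in> h ` carrier ?V"
        by (rule image_eqI) (simp add: scalar_extension_simps quotientI)
    qed
    ultimately show "bij_betw h (carrier ?V) (carrier ?W)"
      by (simp add: bij_betw_def)
  next
    fix X Y assume "X \<in> carrier ?V" "Y \<in> carrier ?V"
    then obtain u v where [simp]: "X = ?R `` {u}" "Y = ?R `` {v}"
      using scalar_extension_carrierD by blast
    show "h (add ?V X Y) = add ?W (h X) (h Y)"
      by (auto simp: scalar_extension_simps h structure_alg_def tensor_coord_add)
    show "h (mult ?V X Y) = mult ?W (h X) (h Y)"
    proof
      show "h (mult ?V X Y) e = mult ?W (h X) (h Y) e" for e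
        using tensor_coord_mult[of u v e] tensor_coord_outside[of e]
        by (cases "e \<in> Basis") (auto simp: scalar_extension_simps h structure_alg_def)
    qed
  next
    fix z X assume "X \<in> carrier ?V"
    then obtain u where [simp]: "X = ?R `` {u}"
      using scalar_extension_carrierD by blast
    show "h (alg.smult ?V z X) = alg.smult ?W z (h X)"
      by (auto simp: scalar_extension_simps h structure_alg_def tensor_coord_smult)
  qed
  then show ?thesis
    by (auto simp: alg_isomorphic_def)
qed

end

section \<open>Independence of the extension field\<close>

lemma scalar_extensions_isomorphic_iff_matrices:
  assumes "extended_algebra scaleA mulA BA \<iota>" "extended_algebra scaleB mulB BB \<iota>"
  shows "scalar_extension \<iota> scaleA mulA \<cong>\<^sub>a scalar_extension \<iota> scaleB mulB \<longleftrightarrow>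
    (\<exists>P Q. iso_matrices BA BB (extended_algebra.structure_const scaleA mulA BA \<iota>)
       (extended_algebra.structure_const scaleB mulB BB \<iota>) P Q)"
proof -
  interpret A: extended_algebra scaleA mulA BA \<iota> by fact
  interpret B: extended_algebra scaleB mulB BB \<iota> by fact
  note A = A.scalar_extension_isomorphic_structure_alg
    and B = B.scalar_extension_isomorphic_structure_alg
  note A' = alg_isomorphic_sym[OF A.scalar_extension_closed A]
    and B' = alg_isomorphic_sym[OF B.scalar_extension_closed B]
  show ?thesis
    using alg_isomorphic_trans[OF A' alg_isomorphic_trans[OF _ B]]
      alg_isomorphic_trans[OF A alg_isomorphic_trans[OF _ B']]
      iso_matrices_of_isomorphic[OF A.finite_Basis B.finite_Basis]
      isomorphic_of_iso_matrices[OF A.finite_Basis B.finite_Basis]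
    by blast
qed

text \<open>
  The entries of \<open>P\<close> and \<open>Q\<close> are finitely many elements of the first field, and a homomorphism \<open>\<psi>\<close>
  over \<open>K\<close> from the ring they generate to the second field carries them to matrices that satisfy
  the same equations. Since \<open>\<psi>\<close> is the identity of \<open>K\<close> up to the two embeddings, it carries the
  structure constants over the first field to those over the second field.
\<close>

lemma scalar_extension_isomorphic_transfer:
  fixes \<iota>\<^sub>1 :: "'k::field \<Rightarrow> 'f::field" and \<iota>\<^sub>2 :: "'k \<Rightarrow> 'w::alg_closed_field"
    and scaleA :: "'k \<Rightarrow> 'a::ab_group_add \<Rightarrow> 'a" and scaleB :: "'k \<Rightarrow> 'b::ab_group_add \<Rightarrow> 'b"
  assumes \<iota>: "field_embedding \<iota>\<^sub>1" "field_embedding \<iota>\<^sub>2"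
    and "finite_dim_algebra_over scaleA mulA" "finite_dim_algebra_over scaleB mulB"
    and iso: "scalar_extension \<iota>\<^sub>1 scaleA mulA \<cong>\<^sub>a scalar_extension \<iota>\<^sub>1 scaleB mulB"
  shows "scalar_extension \<iota>\<^sub>2 scaleA mulA \<cong>\<^sub>a scalar_extension \<iota>\<^sub>2 scaleB mulB"
proof -
  interpret A: finite_dim_algebra_over scaleA mulA by fact
  interpret B: finite_dim_algebra_over scaleB mulB by fact
  obtain BA where BA: "finite_dimensional_vector_space scaleA BA"
    using A.finite_dim by blast
  obtain BB where BB: "finite_dimensional_vector_space scaleB BB"
    using B.finite_dim by blast
  interpret A1: extended_algebra scaleA mulA BA \<iota>\<^sub>1
    by (intro extended_algebra.intro A.algebra_over_axioms BA \<iota>)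
  interpret A2: extended_algebra scaleA mulA BA \<iota>\<^sub>2
    by (intro extended_algebra.intro A.algebra_over_axioms BA \<iota>)
  interpret B1: extended_algebra scaleB mulB BB \<iota>\<^sub>1
    by (intro extended_algebra.intro B.algebra_over_axioms BB \<iota>)
  interpret B2: extended_algebra scaleB mulB BB \<iota>\<^sub>2
    by (intro extended_algebra.intro B.algebra_over_axioms BB \<iota>)
  obtain P Q where PQ: "iso_matrices BA BB A1.structure_const B1.structure_const P Q"
    using iso scalar_extensions_isomorphic_iff_matrices[OF A1.extended_algebra_axioms
        B1.extended_algebra_axioms] by blast
  let ?X = "(\<lambda>(b, a). P b a) ` (BB \<times> BA) \<union> (\<lambda>(a, b). Q a b) ` (BA \<times> BB)"
  have "finite ?X"
    by (simp add: A1.finite_Basis B1.finite_Basis)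
  then obtain S \<psi> where S: "subring_hom S \<psi>" "?X \<subseteq> S" "range \<iota>\<^sub>1 \<subseteq> S"
    and \<psi>: "\<And>c. \<psi> (\<iota>\<^sub>1 c) = \<iota>\<^sub>2 c"
    using specialization_to_alg_closed[OF \<iota>, of ?X] by (metis (no_types, lifting))
  interpret subring_hom S \<psi> by fact
  have "iso_matrices BA BB (\<lambda>a a' e. \<psi> (A1.structure_const a a' e))
      (\<lambda>b b' e. \<psi> (B1.structure_const b b' e)) (\<lambda>b a. \<psi> (P b a)) (\<lambda>a b. \<psi> (Q a b))"
    using PQ by (rule iso_matrices_hom)
      (use S(2,3) in \<open>auto simp: A1.structure_const_def B1.structure_const_def\<close>)
  then have "iso_matrices BA BB A2.structure_const B2.structure_const
      (\<lambda>b a. \<psi> (P b a)) (\<lambda>a b. \<psi> (Q a b))"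
    by (simp add: A1.structure_const_def B1.structure_const_def \<psi>
        flip: A2.structure_const_def B2.structure_const_def)
  then show ?thesis
    using scalar_extensions_isomorphic_iff_matrices[OF A2.extended_algebra_axioms
        B2.extended_algebra_axioms] by blast
qed

theorem corollary4p6:
  fixes \<iota>\<^sub>1 :: "'k::field \<Rightarrow> 'f1::alg_closed_field"
    and \<iota>\<^sub>2 :: "'k \<Rightarrow> 'f2::alg_closed_field"
    and scaleA :: "'k \<Rightarrow> 'a::ab_group_add \<Rightarrow> 'a" and mulA :: "'a \<Rightarrow> 'a \<Rightarrow> 'a"
    and scaleB :: "'k \<Rightarrow> 'b::ab_group_add \<Rightarrow> 'b" and mulB :: "'b \<Rightarrow> 'b \<Rightarrow> 'b"
  assumes "field_embedding \<iota>\<^sub>1" and "field_embedding \<iota>\<^sub>2"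
    and "finite_dim_algebra_over scaleA mulA"
    and "finite_dim_algebra_over scaleB mulB"
  shows "scalar_extension \<iota>\<^sub>1 scaleA mulA \<cong>\<^sub>a scalar_extension \<iota>\<^sub>1 scaleB mulB \<longleftrightarrow>
         scalar_extension \<iota>\<^sub>2 scaleA mulA \<cong>\<^sub>a scalar_extension \<iota>\<^sub>2 scaleB mulB"
  using scalar_extension_isomorphic_transfer[OF assms]
    scalar_extension_isomorphic_transfer[OF assms(2,1,3,4)] by blast

end
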